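(* Let $n,k$ be positive integers with $k\ge 3$. Each tree $T$ with order $n$ and maximum degree $k$ satisfies $$d(Core(T),C(T))\le n-n'-\left\lfloor\frac12\left(n-n'+h'\right)\right\rfloor,$$ where $h'=\left\lceil\frac{\ln(n'(k-2)+1)}{\ln(k-1)}\right\rceil-1$ and $n'$ is the minimum number of vertices in an extended rgood tree $T_u$ with maximum degree $k$ and root $u$ such that $F_{T_u}(u)\ge n-|V(T_u)|$. This inequality is tight for the tree (of order $n$) formed by identifying the root of the extended rgood tree with one end of a path of appropriate length.
   Context: For vertices $u,v$ of a tree $T$, $d(u,v)$ is the number of edges on the unique path joining them. The eccentricity of $v$ is $ecc_T(v)=\max_{u\in V(T)}d(v,u)$, and the center $C(T)$ is the set of vertices of minimum eccentricity. A subtree of $T$ is a connected subgraph induced on a nonempty set of vertices; $F_T(v)$ is the number of subtrees of $T$ containing $v$, and the subtree core $Core(T)$ is the set of vertices maximizing $F_T$. For vertex sets $S,S'$, $d(S,S')=\min\{d(u,v):u\in S,\ v\in S'\}$. Rooted greedy tree: given a tree degree sequence in non-increasing order with one entry distinguished as the root degree, let $d'_1\ge d'_2\ge\dots$ be the sequence with that entry removed. The rooted greedy tree has a root of the distinguished degree; the children of the root receive, from left to right, the degrees $d'_1,d'_2,\dots$; then, level by level, the vertices of a level are processed from left to right, each non-root vertex of degree $d$ being joined to the next $d-1$ vertices of the following level, and the vertices of the following level receive, from left to right, the next largest unused entries in non-increasing order. Extended rgood tree with order $m$ and maximum degree $k$: the rooted greedy tree on $m$ vertices with root degree $k-1$ and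 degree sequence $(k,k,\dots,k,k-1,s,1,\dots,1)$ for some $1\le s<k$.
   Formalization: Tightness fails for some n (k=3, n=5: bound 1, distance 0); equality for the described tree is claimed only for n>k with n-n'+h' even and F_{T_u}(u) ≠ n-n', and it is added that for each k this tree attains equality for infinitely many n. *)

theory Defs
  imports Complex_Main
begin

datatype 'a graph = Graph (verts: "'a set") (edges: "'a set set")

definition simple_graph :: "'a graph \<Rightarrow> bool" where
  "simple_graph G \<longleftrightarrow> finite (verts G) \<and>
     (\<forall>e\<in>edges G. \<exists>u v. u \<in> verts G \<and> v \<in> verts G \<and> u \<noteq> v \<and> e = {u, v})"

definition walk :: "'a graph \<Rightarrow> 'a list \<Rightarrow> bool" where
  "walk G p \<longleftrightarrow> p \<noteq> [] \<and> set p \<subseteq> verts G \<and>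
     (\<forall>i. Suc i < length p \<longrightarrow> {p ! i, p ! Suc i} \<in> edges G)"

definition path_between :: "'a graph \<Rightarrow> 'a \<Rightarrow> 'a \<Rightarrow> 'a list \<Rightarrow> bool" where
  "path_between G u v p \<longleftrightarrow> walk G p \<and> distinct p \<and> hd p = u \<and> last p = v"

definition connected_graph :: "'a graph \<Rightarrow> bool" where
  "connected_graph G \<longleftrightarrow> verts G \<noteq> {} \<and>
     (\<forall>u\<in>verts G. \<forall>v\<in>verts G. \<exists>p. walk G p \<and> hd p = u \<and> last p = v)"

definition cycle :: "'a graph \<Rightarrow> 'a list \<Rightarrow> bool" where
  "cycle G c \<longleftrightarrow> 3 \<le> length c \<and> distinct c \<and> walk G (c @ [hd c])"

definition is_tree :: "'a graph \<Rightarrow> bool" where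
  "is_tree G \<longleftrightarrow> simple_graph G \<and> connected_graph G \<and> (\<nexists>c. cycle G c)"

abbreviation order :: "'a graph \<Rightarrow> nat" where
  "order G \<equiv> card (verts G)"

definition degree :: "'a graph \<Rightarrow> 'a \<Rightarrow> nat" where
  "degree G v = card {e \<in> edges G. v \<in> e}"

definition max_degree :: "'a graph \<Rightarrow> nat" where
  "max_degree G = Max (degree G ` verts G)"

text \<open>The following notions are meant for trees only, where the path between two vertices
  is unique. A path with \<open>l\<close> edges is a list of \<open>l + 1\<close> vertices.\<close>

definition tdist :: "'a graph \<Rightarrow> 'a \<Rightarrow> 'a \<Rightarrow> nat" where
  "tdist T u v = length (THE p. path_between T u v p) - 1"

definition ecc :: "'a graph \<Rightarrow> 'a \<Rightarrow> nat" where
  "ecc T v = Max ((\<lambda>u. tdist T v u) ` verts T)"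

definition center :: "'a graph \<Rightarrow> 'a set" where
  "center T = {v \<in> verts T. \<forall>u\<in>verts T. ecc T v \<le> ecc T u}"

definition induced :: "'a graph \<Rightarrow> 'a set \<Rightarrow> 'a graph" where
  "induced G S = Graph S {e \<in> edges G. e \<subseteq> S}"

text \<open>A subtree, being an induced subgraph, is identified with its vertex set.\<close>

definition subtrees :: "'a graph \<Rightarrow> 'a set set" where
  "subtrees T = {S. S \<noteq> {} \<and> S \<subseteq> verts T \<and> connected_graph (induced T S)}"

definition num_subtrees_at :: "'a graph \<Rightarrow> 'a \<Rightarrow> nat" where
  "num_subtrees_at T v = card {S \<in> subtrees T. v \<in> S}"

definition subtree_core :: "'a graph \<Rightarrow> 'a set" where
  "subtree_core T =
     {v \<in> verts T. \<forall>u\<in>verts T. num_subtrees_at T u \<le> num_subtrees_at T v}"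

definition set_dist :: "'a graph \<Rightarrow> 'a set \<Rightarrow> 'a set \<Rightarrow> nat" where
  "set_dist T S S' = Min {tdist T u v | u v. u \<in> S \<and> v \<in> S'}"

text \<open>The rooted greedy tree of a non-increasing tree degree sequence \<open>ds\<close> with distinguished
  root degree \<open>r\<close>. Its vertices are numbered level by level, and from left to right within a
  level, starting from the root \<open>0\<close>. In this numbering the degrees after the root's are handed
  out in the order of the sequence \<open>remove1 r ds\<close>, and every vertex takes as its children the
  next block of vertices not yet used as children.\<close>

definition num_children :: "nat list \<Rightarrow> nat \<Rightarrow> nat \<Rightarrow> nat" where
  "num_children ds r i = (if i = 0 then r else remove1 r ds ! (i - 1) - 1)"

definition children :: "nat list \<Rightarrow> nat \<Rightarrow> nat \<Rightarrow> nat set" where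
  "children ds r i =
     {1 + (\<Sum>j<i. num_children ds r j) ..< 1 + (\<Sum>j<Suc i. num_children ds r j)}"

definition rooted_greedy_tree :: "nat list \<Rightarrow> nat \<Rightarrow> nat graph" where
  "rooted_greedy_tree ds r =
     Graph {..<length ds} {{i, j} | i j. i < length ds \<and> j \<in> children ds r i}"

text \<open>The equation on the degree sum says that \<open>ds\<close> is the degree sequence of a tree.
  Note that \<open>k\<close> is a parameter: the number \<open>a\<close> of entries equal to \<open>k\<close> may be zero
  (the smallest case is the star with \<open>k - 1\<close> leaves), and the root reaches degree \<open>k\<close> only
  when a path is attached to it.\<close>

definition extended_rgood :: "nat \<Rightarrow> nat \<Rightarrow> nat graph \<Rightarrow> bool" where
  "extended_rgood k m T \<longleftrightarrow> (\<exists>a s b ds.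
     1 \<le> s \<and> s < k \<and>
     ds = replicate a k @ [k - 1, s] @ replicate b 1 \<and>
     length ds = m \<and> sum_list ds = 2 * (m - 1) \<and>
     T = rooted_greedy_tree ds (k - 1))"

definition n_prime :: "nat \<Rightarrow> nat \<Rightarrow> nat" where
  "n_prime n k = (LEAST m. \<exists>T. extended_rgood k m T \<and>
     int (num_subtrees_at T 0) \<ge> int n - int (order T))"

definition h_prime :: "nat \<Rightarrow> nat \<Rightarrow> int" where
  "h_prime n k =
     \<lceil>ln (real (n_prime n k) * (real k - 2) + 1) / ln (real k - 1)\<rceil> - 1"

definition dist_bound :: "nat \<Rightarrow> nat \<Rightarrow> int" where
  "dist_bound n k = int n - int (n_prime n k)
     - \<lfloor>1 / 2 * (real n - real (n_prime n k) + real_of_int (h_prime n k))\<rfloor>"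

text \<open>Identify the vertex \<open>u\<close> of \<open>G\<close> with one end of a path whose other vertices are,
  in order, the new vertices \<open>xs\<close>.\<close>

definition attach_path :: "'a graph \<Rightarrow> 'a \<Rightarrow> 'a list \<Rightarrow> 'a graph" where
  "attach_path G u xs = Graph (verts G \<union> set (u # xs))
     (edges G \<union> {{(u # xs) ! i, (u # xs) ! Suc i} | i. Suc i < length (u # xs)})"

text \<open>For an extended rgood tree \<open>T\<close> of order \<open>n_prime n k\<close> this tree has order \<open>n\<close>.\<close>

definition rgood_with_path :: "nat \<Rightarrow> nat \<Rightarrow> nat graph \<Rightarrow> nat graph" where
  "rgood_with_path n k T = attach_path T 0 [n_prime n k ..< n]"

end

theory Submission
  imports Defs
begin

text \<open>Let \<open>q = k - 1\<close>. Choose \<open>u\<close> in the subtree core and \<open>c\<close> in the center at minimum distance \<open>D > 0\<close>,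
  and cut the first edge \<open>{u, v}\<close> of the path from \<open>u\<close> to \<open>c\<close> into sides \<open>A\<close> and \<open>B\<close>. Since
  \<open>F\<^sub>T(u) = F\<^sub>A(u) (1 + F\<^sub>B(v))\<close> and \<open>F\<^sub>T(v) = F\<^sub>B(v) (1 + F\<^sub>A(u))\<close>, the choice of \<open>u\<close> gives
  \<open>F\<^sub>A(u) > F\<^sub>B(v) \<ge> n - card A\<close>. Among \<open>q\<close>-ary trees of given order the heap-ordered one maximizes the
  number of subtrees containing the root, hence \<open>n' \<le> card A\<close>, and \<open>A\<close> has height at least \<open>h'\<close>.
  The center then forces \<open>B\<close> to contain a path on \<open>2 D + h'\<close> vertices, so \<open>n' + 2 D + h' \<le> n\<close>.

  The extremal property of the heap rests on exchanges between two branches of orders \<open>a\<close> and \<open>b\<close>: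
  a pair whose heights differ too much can be strictly improved, and for branches with the same
  number of complete levels filling one of the last levels first is best.\<close>

section \<open>Counting root subtrees of heap-ordered trees\<close>

text \<open>The exchange only moves vertices between the \<open>q\<close> branches of one root, so
  the extremal problem concerns \<open>q\<close> numbers of fixed sum; actual trees enter later, by
  induction over rooted trees.

  The path in \<open>B\<close>: as \<open>u\<close> and \<open>c\<close> are a closest pair, the
  vertex \<open>c'\<close> before \<open>c\<close> is not central, so a vertex \<open>w\<close>
  farthest from \<open>c'\<close> lies beyond \<open>c\<close>, at distance at least the
  eccentricity of \<open>c\<close>. That eccentricity is at least \<open>D + h'\<close>, because
  \<open>A\<close> has a vertex at depth \<open>h'\<close> below \<open>u\<close>. From
  \<open>v\<close> to \<open>c\<close> there are \<open>D\<close> vertices, and at least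
  \<open>D + h'\<close> more follow up to \<open>w\<close>.

  Minimality of \<open>n'\<close> speaks only of orders from \<open>k\<close> on, the smallest
  extended rgood tree being a star on \<open>k\<close> vertices. A smaller \<open>A\<close> is
  impossible: a vertex of degree \<open>k\<close> would lie in \<open>B\<close> and give at least
  \<open>2 ^ q\<close> subtrees at \<open>v\<close>, at least as many as \<open>A\<close> has at
  \<open>u\<close>.

  Rounding: what is proved is \<open>2 D \<le> n - n' - h'\<close>, whereas the stated bound is half
  of the right-hand side rounded up. Equality therefore needs the right-hand side to be even. It
  also needs \<open>F(u)\<close> to differ from \<open>n - n'\<close>: otherwise the root and its
  neighbour on the path tie, and the core may reach onto the path.\<close>

text \<open>The tree that \<open>extended_rgood\<close> describes is the heap-ordered \<open>q\<close>-ary tree, \<open>q = k - 1\<close>. With \<open>h\<close>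
  complete levels and \<open>t \<le> q ^ h\<close> vertices on the next one it has \<open>level_count q h t\<close> subtrees containing
  the root: the truncated subtraction and the minimum say how many of the \<open>t\<close> last vertices lie
  below the \<open>j\<close>-th child of the root. \<open>heap_count q m\<close> is the same number in terms of the order \<open>m\<close>,
  and \<open>heap_count q 0 = 0\<close> encodes a missing child.\<close>

definition perfect_size :: "nat \<Rightarrow> nat \<Rightarrow> nat" where
  "perfect_size q h = (\<Sum>i<h. q ^ i)"

fun level_count :: "nat \<Rightarrow> nat \<Rightarrow> nat \<Rightarrow> nat" where
  "level_count q 0 t = t"
| "level_count q (Suc h) t = (\<Prod>j<q. Suc (level_count q h (min (q ^ h) (t - j * q ^ h))))"

definition heap_count :: "nat \<Rightarrow> nat \<Rightarrow> nat" where
  "heap_count q m = (let h = (LEAST h. m \<le> perfect_size q (Suc h)) in level_count q h (m - perfect_size q h))"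

lemma perfect_size_0 [simp]: "perfect_size q 0 = 0"
  by (simp add: perfect_size_def)

lemma perfect_size_Suc: "perfect_size q (Suc h) = perfect_size q h + q ^ h"
  by (simp add: perfect_size_def)

lemma perfect_size_Suc': "perfect_size q (Suc h) = Suc (q * perfect_size q h)"
proof -
  have "perfect_size q (Suc h) = (\<Sum>i<Suc h. q ^ i)" by (simp add: perfect_size_def)
  also have "\<dots> = 1 + (\<Sum>i<h. q ^ Suc i)"
    by (subst sum.lessThan_Suc_shift) simp
  finally show ?thesis by (simp add: perfect_size_def sum_distrib_left)
qed

text \<open>Expand the nonnegative product of \<open>X' - X\<close> and \<open>X' - Y\<close>.
  Together with the product inequality this lets an exchange survive when 1 is added to every
  factor, which is what happens on passing to the parent level.\<close>

lemma sum_le_sum_if_prod_le: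
  fixes X Y X' Y' :: real
  assumes "X \<le> X'" "Y \<le> X'" "X * Y \<le> X' * Y'" "0 < X'"
  shows "X + Y \<le> X' + Y'"
proof -
  have "0 \<le> (X' - X) * (X' - Y)" using assms by simp
  hence "X' * (X + Y) \<le> X' * (X' + Y')" using assms(3) by (simp add: algebra_simps)
  thus ?thesis using assms(4) by simp
qed

lemma prod_fun_upd:
  fixes f :: "'b \<Rightarrow> 'c::comm_monoid_mult"
  assumes "finite A" "i \<in> A"
  shows "(\<Prod>j\<in>A. f ((x(i := b)) j)) = f b * (\<Prod>j\<in>A - {i}. f (x j))"
proof -
  have "(\<Prod>j\<in>A. f ((x(i := b)) j)) = f ((x(i := b)) i) * (\<Prod>j\<in>A - {i}. f ((x(i := b)) j))"
    using assms by (rule prod.remove)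
  also have "(\<Prod>j\<in>A - {i}. f ((x(i := b)) j)) = (\<Prod>j\<in>A - {i}. f (x j))"
    by (rule prod.cong) auto
  finally show ?thesis by simp
qed

lemma sum_fun_upd:
  fixes x :: "'a \<Rightarrow> 'c::comm_monoid_add"
  assumes "finite A" "i \<in> A"
  shows "(\<Sum>j\<in>A. (x(i := b)) j) = b + (\<Sum>j\<in>A - {i}. x j)"
proof -
  have "(\<Sum>j\<in>A. (x(i := b)) j) = (x(i := b)) i + (\<Sum>j\<in>A - {i}. (x(i := b)) j)"
    using assms by (rule sum.remove)
  also have "(\<Sum>j\<in>A - {i}. (x(i := b)) j) = (\<Sum>j\<in>A - {i}. x j)"
    by (rule sum.cong) auto
  finally show ?thesis by simp
qed

context
  fixes q :: nat
  assumes q2: "2 \<le> q"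
begin

lemma q_pos [simp]: "0 < q"
  using q2 by simp

lemma qpow_pos: "0 < q ^ h"
  by simp

lemma perfect_size_strict_mono: "h < h' \<Longrightarrow> perfect_size q h < perfect_size q h'"
  by (rule lift_Suc_mono_less) (simp_all add: perfect_size_Suc)

lemma perfect_size_mono: "h \<le> h' \<Longrightarrow> perfect_size q h \<le> perfect_size q h'"
  using perfect_size_strict_mono[of h h'] by (cases "h = h'") auto

lemma perfect_size_ge: "h \<le> perfect_size q h"
proof (induction h)
  case (Suc h)
  show ?case using Suc qpow_pos[of h] unfolding perfect_size_Suc by linarith
qed simp

lemma level_count_0: "level_count q (Suc h) 0 = Suc (level_count q h 0) ^ q"
  by simp

text \<open>A full last level may also be read as one more complete level with nothing below it;
  both readings must count the same.\<close>

lemma level_count_full: "level_count q (Suc h) 0 = level_count q h (q ^ h)"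
proof (induction h)
  case (Suc h)
  have *: "min (q ^ h) (q ^ Suc h - j * q ^ h) = q ^ h" if "j < q" for j
  proof -
    have "Suc j * q ^ h \<le> q * q ^ h" using that by (intro mult_right_mono) auto
    thus ?thesis by simp
  qed
  have "level_count q (Suc h) (q ^ Suc h) = (\<Prod>j<q. Suc (level_count q h (q ^ h)))"
    unfolding level_count.simps by (rule prod.cong) (use * in auto)
  also have "\<dots> = Suc (level_count q (Suc h) 0) ^ q"
    using Suc by simp
  finally show ?case by (simp del: level_count.simps add: level_count_0)
qed simp

text \<open>No child loses vertices, and child number \<open>t div q ^ h\<close>, the first one that
  is not full, gains some.\<close>

lemma level_count_strict_mono: "t < t' \<Longrightarrow> t' \<le> q ^ h \<Longrightarrow> level_count q h t < level_count q h t'"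
proof (induction h arbitrary: t t')
  case (Suc h)
  let ?Q = "q ^ h"
  have mono: "level_count q h a \<le> level_count q h b" if "a \<le> b" "b \<le> ?Q" for a b
    using Suc.IH[of a b] that by (cases "a = b") auto
  let ?j = "t div ?Q"
  have j: "?j < q"
    using Suc.prems by (simp add: less_mult_imp_div_less)
  have 1: "min ?Q (t - ?j * ?Q) = t mod ?Q" unfolding minus_div_mult_eq_mod
    by (rule min.absorb2) (rule less_imp_le[OF mod_less_divisor[OF qpow_pos]])
  have 2: "t mod ?Q < min ?Q (t' - ?j * ?Q)"
    using Suc.prems(1) div_mult_mod_eq[of t ?Q] mod_less_divisor[OF qpow_pos, of t h] by linarith
  show ?case unfolding level_count.simps
  proof (rule prod_mono_strict[of ?j])
    show "Suc (level_count q h (min ?Q (t - ?j * ?Q))) < Suc (level_count q h (min ?Q (t' - ?j * ?Q)))"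
      using 1 2 by (auto intro!: Suc.IH)
  qed (use j Suc.prems in \<open>auto intro!: mono min.mono diff_le_mono\<close>)
qed simp

lemma level_count_mono: "t \<le> t' \<Longrightarrow> t' \<le> q ^ h \<Longrightarrow> level_count q h t \<le> level_count q h t'"
  using level_count_strict_mono[of t t' h] by (cases "t = t'") auto

text \<open>A perfect order belongs to two windows, of which the definition takes the lower one. By
  \<open>level_count_full\<close> either may be used.\<close>

lemma heap_count_eq:
  assumes "perfect_size q h \<le> m" "m \<le> perfect_size q (Suc h)"
  shows "heap_count q m = level_count q h (m - perfect_size q h)"
proof -
  define h' where "h' = (LEAST h. m \<le> perfect_size q (Suc h))"
  have le: "h' \<le> h" unfolding h'_def using assms(2) by (rule Least_le)
  have up: "m \<le> perfect_size q (Suc h')" unfolding h'_def using assms(2) by (rule LeastI)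
  have heap_count: "heap_count q m = level_count q h' (m - perfect_size q h')" by (simp add: heap_count_def h'_def Let_def)
  show ?thesis
  proof (cases "h' = h")
    case True
    thus ?thesis by (simp add: heap_count)
  next
    case False
    hence "perfect_size q (Suc h') \<le> perfect_size q h" using le by (intro perfect_size_mono) auto
    hence m: "m = perfect_size q h" "m = perfect_size q (Suc h')" using up assms(1) by auto
    hence "h = Suc h'" using perfect_size_strict_mono[of h "Suc h'"] perfect_size_strict_mono[of "Suc h'" h]
      by (cases h "Suc h'" rule: linorder_cases) auto
    thus ?thesis using m heap_count level_count_full[of h'] by (simp add: perfect_size_Suc del: level_count.simps)
  qed
qed

lemma heap_count_perfect_size_add: "t \<le> q ^ h \<Longrightarrow> heap_count q (perfect_size q h + t) = level_count q h t"
  by (subst heap_count_eq[of h]) (simp_all add: perfect_size_Suc)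

lemma perfect_size_bracket:
  assumes "0 < m"
  obtains h where "perfect_size q h < m" "m \<le> perfect_size q (Suc h)"
proof -
  let ?h = "LEAST h. m \<le> perfect_size q (Suc h)"
  have "m \<le> perfect_size q (Suc m)" using perfect_size_ge[of "Suc m"] by simp
  hence up: "m \<le> perfect_size q (Suc ?h)" by (rule LeastI)
  have "perfect_size q ?h < m"
  proof (cases ?h)
    case (Suc i)
    thus ?thesis using not_less_Least[of i "\<lambda>h. m \<le> perfect_size q (Suc h)"] by simp
  qed (use assms in simp)
  thus ?thesis using up that by blast
qed

lemma heap_count_0 [simp]: "heap_count q 0 = 0"
  using heap_count_perfect_size_add[of 0 0] by simp

lemma heap_count_strict_mono: "m < m' \<Longrightarrow> heap_count q m < heap_count q m'"
proof (rule lift_Suc_mono_less[where f = "heap_count q"])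
  fix m
  obtain h where h: "perfect_size q h < Suc m" "Suc m \<le> perfect_size q (Suc h)"
    using perfect_size_bracket[of "Suc m"] by auto
  have "heap_count q m = level_count q h (m - perfect_size q h)" "heap_count q (Suc m) = level_count q h (Suc m - perfect_size q h)"
    using h by (auto intro!: heap_count_eq)
  moreover have "level_count q h (m - perfect_size q h) < level_count q h (Suc m - perfect_size q h)"
    using h by (intro level_count_strict_mono) (auto simp: perfect_size_Suc)
  ultimately show "heap_count q m < heap_count q (Suc m)" by simp
qed

lemma heap_count_mono: "m \<le> m' \<Longrightarrow> heap_count q m \<le> heap_count q m'"
  using heap_count_strict_mono[of m m'] by (cases "m = m'") auto

lemma heap_count_ge: "m \<le> heap_count q m"
proof (induction m)
  case (Suc m)
  thus ?case using heap_count_strict_mono[of m "Suc m"] by simp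
qed simp

section \<open>Ratios of child factors and exchanges on the last level\<close>

definition Suc_level_count :: "nat \<Rightarrow> nat \<Rightarrow> real" where
  "Suc_level_count h t = 1 + real (level_count q h t)"

text \<open>For \<open>t \<le> N * q ^ h\<close> this is the value, relative to \<open>t = 0\<close>, of a forest of \<open>N\<close> heaps with
  \<open>h\<close> complete levels that share \<open>t\<close> further vertices greedily; it does not depend on \<open>N\<close>.\<close>

definition level_ratio :: "nat \<Rightarrow> nat \<Rightarrow> real" where
  "level_ratio h t = (Suc_level_count h (q ^ h) / Suc_level_count h 0) ^ (t div q ^ h) * (Suc_level_count h (t mod q ^ h) / Suc_level_count h 0)"

lemma Suc_level_count_pos [simp]: "0 < Suc_level_count h t" "Suc_level_count h t \<noteq> 0"
  by (simp_all add: Suc_level_count_def add_pos_nonneg)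

lemma level_ratio_pos [simp]: "0 < level_ratio h t"
  by (simp add: level_ratio_def)

lemma level_ratio_0 [simp]: "level_ratio h 0 = 1"
  by (simp add: level_ratio_def)

text \<open>The value \<open>r = q ^ h\<close> is the delicate one: there the remainder is 0 and the
  quotient \<open>Suc i\<close>, but the factor of a full child makes up for it. Later case splits
  may thus treat a full child as a partial one.\<close>

lemma level_ratio_step: "r \<le> q ^ h \<Longrightarrow> level_ratio h (i * q ^ h + r) = (Suc_level_count h (q ^ h) / Suc_level_count h 0) ^ i * (Suc_level_count h r / Suc_level_count h 0)"
proof (cases "r = q ^ h")
  case True
  hence "i * q ^ h + r = Suc i * q ^ h" by simp
  hence "(i * q ^ h + r) div q ^ h = Suc i" "(i * q ^ h + r) mod q ^ h = 0"
    by (metis div_mult_self_is_m qpow_pos) (metis mod_mult_self2_is_0 \<open>i * q ^ h + r = Suc i * q ^ h\<close>)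
  thus ?thesis using True by (simp add: level_ratio_def)
qed (simp add: level_ratio_def)

text \<open>A child that receives none of the \<open>t\<close> vertices has ratio 1, hence the
  independence of \<open>N\<close>.\<close>

lemma level_ratio_prod:
  assumes "t \<le> N * q ^ h"
  shows "(\<Prod>j<N. Suc_level_count h (min (q ^ h) (t - j * q ^ h)) / Suc_level_count h 0) = level_ratio h t"
  using assms
proof (induction N)
  case (Suc N)
  show ?case
  proof (cases "t \<le> N * q ^ h")
    case True
    thus ?thesis using Suc.IH by simp
  next
    case False
    define r where "r = t - N * q ^ h"
    have r: "t = N * q ^ h + r" "r \<le> q ^ h" using False Suc.prems by (auto simp: r_def)
    have "min (q ^ h) (t - j * q ^ h) = q ^ h" if "j < N" for j
    proof -
      have "Suc j * q ^ h \<le> N * q ^ h" using that by (intro mult_right_mono) auto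
      thus ?thesis using False by simp
    qed
    hence "(\<Prod>j<N. Suc_level_count h (min (q ^ h) (t - j * q ^ h)) / Suc_level_count h 0) = (Suc_level_count h (q ^ h) / Suc_level_count h 0) ^ N"
      by simp
    thus ?thesis using r by (simp add: level_ratio_step)
  qed
qed simp

lemma level_count_Suc_level_ratio:
  assumes "t \<le> q ^ Suc h"
  shows "real (level_count q (Suc h) t) = Suc_level_count h 0 ^ q * level_ratio h t"
proof -
  have "real (level_count q (Suc h) t) = (\<Prod>j<q. Suc_level_count h 0 * (Suc_level_count h (min (q ^ h) (t - j * q ^ h)) / Suc_level_count h 0))"
    by (simp add: Suc_level_count_def)
  also have "\<dots> = Suc_level_count h 0 ^ q * (\<Prod>j<q. Suc_level_count h (min (q ^ h) (t - j * q ^ h)) / Suc_level_count h 0)"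
    by (simp only: prod.distrib prod_constant card_lessThan)
  finally show ?thesis using assms by (simp only: level_ratio_prod power_Suc)
qed

lemma level_ratio_add_mult: "level_ratio h (i * q ^ h + t) = (Suc_level_count h (q ^ h) / Suc_level_count h 0) ^ i * level_ratio h t"
proof -
  have "(i * q ^ h + t) div q ^ h = i + t div q ^ h" using qpow_pos[of h] by (simp del: q_pos)
  thus ?thesis by (simp add: level_ratio_def power_add)
qed

text \<open>Two sibling heaps with \<open>h\<close> complete levels hold \<open>r + s\<close>
  vertices on the next level. The two clauses say that filling one of them first is best, according
  to whether one of them can take all or gets full and leaves a rest.\<close>

definition level_exchange :: "nat \<Rightarrow> bool" where
  "level_exchange h \<longleftrightarrow> (\<forall>r\<le>q ^ h. \<forall>s\<le>q ^ h.
     (r + s \<le> q ^ h \<longrightarrow> Suc_level_count h r * Suc_level_count h s \<le> Suc_level_count h (r + s) * Suc_level_count h 0) \<and>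
     (q ^ h \<le> r + s \<longrightarrow> Suc_level_count h r * Suc_level_count h s \<le> Suc_level_count h (q ^ h) * Suc_level_count h (r + s - q ^ h)))"

text \<open>Complete blocks of \<open>q ^ h\<close> vertices contribute equal powers on both sides,
  which leaves the two remainders; for these the claim is one of the two clauses of
  \<open>level_exchange\<close>.\<close>

lemma level_ratio_superadd:
  assumes "level_exchange h"
  shows "level_ratio h s * level_ratio h t \<le> level_ratio h (s + t)"
proof -
  let ?Q = "q ^ h" let ?\<rho> = "Suc_level_count h ?Q / Suc_level_count h 0"
  define i r j r' where "i = s div ?Q" "r = s mod ?Q" "j = t div ?Q" "r' = t mod ?Q"
  have r: "r \<le> ?Q" "r' \<le> ?Q" unfolding i_r_j_r'_def
    by (auto intro!: less_imp_le mod_less_divisor qpow_pos)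
  have st: "s = i * ?Q + r" "t = j * ?Q + r'" unfolding i_r_j_r'_def by (simp_all only: div_mult_mod_eq)
  have lhs: "level_ratio h s * level_ratio h t = ?\<rho> ^ (i + j) * (Suc_level_count h r * Suc_level_count h r' / (Suc_level_count h 0 * Suc_level_count h 0))"
    unfolding st using r by (simp add: level_ratio_step power_add)
  have sum: "s + t = (i + j) * ?Q + (r + r')" by (simp add: st algebra_simps)
  have "Suc_level_count h r * Suc_level_count h r' / (Suc_level_count h 0 * Suc_level_count h 0) \<le> level_ratio h (r + r')"
  proof (cases "r + r' \<le> ?Q")
    case True
    have "Suc_level_count h r * Suc_level_count h r' \<le> Suc_level_count h (r + r') * Suc_level_count h 0"
      using assms r True by (auto simp: level_exchange_def)
    thus ?thesis using level_ratio_step[OF True, of 0] by (simp add: field_simps)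
  next
    case False
    have "Suc_level_count h r * Suc_level_count h r' \<le> Suc_level_count h ?Q * Suc_level_count h (r + r' - ?Q)"
      using assms r False by (auto simp: level_exchange_def)
    moreover have "level_ratio h (r + r') = ?\<rho> * (Suc_level_count h (r + r' - ?Q) / Suc_level_count h 0)"
      using level_ratio_step[of "r + r' - ?Q" h 1] False r by simp
    ultimately show ?thesis by (simp add: field_simps)
  qed
  thus ?thesis unfolding lhs sum level_ratio_add_mult
    by (intro mult_left_mono zero_le_power divide_nonneg_nonneg less_imp_le[OF Suc_level_count_pos(1)])
qed

text \<open>One level up a child factor is \<open>1 + c * level_ratio h t\<close>. Superadditivity
  at level \<open>h\<close> gives the inequality of the products,
  \<open>sum_le_sum_if_prod_le\<close> the one of the sums, and adding both handles the extra
  1.\<close>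

lemma level_exchange: "level_exchange h"
proof (induction h)
  case 0
  have *: "r = 0 \<or> r = 1" if "r \<le> 1" for r :: nat using that by linarith
  show ?case unfolding level_exchange_def
  proof (intro allI impI)
    fix r s assume "r \<le> q ^ 0" "s \<le> q ^ 0"
    with *[of r] *[of s]
    consider "r = 0" "s = 0" | "r = 1" "s = 0" | "r = 0" "s = 1" | "r = 1" "s = 1" by auto
    thus "(r + s \<le> q ^ 0 \<longrightarrow> Suc_level_count 0 r * Suc_level_count 0 s \<le> Suc_level_count 0 (r + s) * Suc_level_count 0 0) \<and>
     (q ^ 0 \<le> r + s \<longrightarrow> Suc_level_count 0 r * Suc_level_count 0 s \<le> Suc_level_count 0 (q ^ 0) * Suc_level_count 0 (r + s - q ^ 0))"
      by cases (simp_all add: Suc_level_count_def)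
  qed
next
  case (Suc h)
  let ?Q = "q ^ Suc h" let ?c = "Suc_level_count h 0 ^ q"
  have Suc_level_count: "Suc_level_count (Suc h) t = 1 + ?c * level_ratio h t" if "t \<le> ?Q" for t
    using level_count_Suc_level_ratio[OF that] by (simp add: Suc_level_count_def)
  have mono: "?c * level_ratio h t \<le> ?c * level_ratio h t'" if "t \<le> t'" "t' \<le> ?Q" for t t'
    using level_count_mono[OF that] level_count_Suc_level_ratio[of t h] level_count_Suc_level_ratio[of t' h] that by linarith
  \<comment> \<open>The fuller heap after the exchange is \<open>a\<close>, the other is
    \<open>b\<close>. The last premise says that splitting \<open>r + s\<close> into these two loses
    nothing; it holds for \<open>b = 0\<close> and for \<open>a = q ^ Suc h\<close>.\<close>
  have main: "Suc_level_count (Suc h) r * Suc_level_count (Suc h) s \<le> Suc_level_count (Suc h) a * Suc_level_count (Suc h) b"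
    if "r \<le> a" "s \<le> a" "a \<le> ?Q" "b \<le> ?Q" "level_ratio h (r + s) = level_ratio h a * level_ratio h b" for r s a b
  proof -
    have "(?c * level_ratio h r) * (?c * level_ratio h s) = ?c * ?c * (level_ratio h r * level_ratio h s)" by simp
    also have "\<dots> \<le> ?c * ?c * (level_ratio h a * level_ratio h b)"
      using level_ratio_superadd[OF Suc, of r s] that(5) by (intro mult_left_mono) auto
    finally have prod: "(?c * level_ratio h r) * (?c * level_ratio h s) \<le> (?c * level_ratio h a) * (?c * level_ratio h b)" by simp
    have "?c * level_ratio h r + ?c * level_ratio h s \<le> ?c * level_ratio h a + ?c * level_ratio h b"
      using mono that prod by (intro sum_le_sum_if_prod_le) auto
    hence "(1 + ?c * level_ratio h r) * (1 + ?c * level_ratio h s) \<le> (1 + ?c * level_ratio h a) * (1 + ?c * level_ratio h b)"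
      using prod unfolding ring_distribs by linarith
    thus ?thesis using that by (simp only: Suc_level_count order.trans[OF that(1,3)] order.trans[OF that(2,3)])
  qed
  show ?case unfolding level_exchange_def
  proof (intro allI impI conjI)
    fix r s assume "r \<le> ?Q" "s \<le> ?Q" "r + s \<le> ?Q"
    thus "Suc_level_count (Suc h) r * Suc_level_count (Suc h) s \<le> Suc_level_count (Suc h) (r + s) * Suc_level_count (Suc h) 0"
      by (intro main) auto
  next
    fix r s assume *: "r \<le> ?Q" "s \<le> ?Q" "?Q \<le> r + s"
    show "Suc_level_count (Suc h) r * Suc_level_count (Suc h) s \<le> Suc_level_count (Suc h) ?Q * Suc_level_count (Suc h) (r + s - ?Q)"
    proof (rule main)
      have "r + s = q * q ^ h + (r + s - ?Q)" using * by simp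
      hence "level_ratio h (r + s) = (Suc_level_count h (q ^ h) / Suc_level_count h 0) ^ q * level_ratio h (r + s - ?Q)"
        by (metis level_ratio_add_mult)
      moreover have "level_ratio h ?Q = (Suc_level_count h (q ^ h) / Suc_level_count h 0) ^ q"
        using level_ratio_add_mult[of h q 0] by simp
      ultimately show "level_ratio h (r + s) = level_ratio h ?Q * level_ratio h (r + s - ?Q)" by simp
    qed (use * in auto)
  qed
qed

section \<open>Splitting a heap at its root, and optimality of heaps\<close>

lemma sum_children: "t \<le> N * q ^ h \<Longrightarrow> (\<Sum>j<N. min (q ^ h) (t - j * q ^ h)) = t"
proof (induction N arbitrary: t)
  case (Suc N)
  show ?case
  proof (cases "t \<le> N * q ^ h")
    case True
    thus ?thesis using Suc.IH by simp
  next
    case False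
    have "min (q ^ h) (t - j * q ^ h) = min (q ^ h) (N * q ^ h - j * q ^ h)" if "j < N" for j
    proof -
      have "Suc j * q ^ h \<le> N * q ^ h" using that by (intro mult_right_mono) auto
      thus ?thesis using False by simp
    qed
    hence "(\<Sum>j<N. min (q ^ h) (t - j * q ^ h)) = N * q ^ h"
      using Suc.IH[of "N * q ^ h"] by simp
    thus ?thesis using False Suc.prems by simp
  qed
qed simp

lemma heap_count_children:
  assumes "t \<le> q ^ Suc h"
  defines "x \<equiv> \<lambda>j. perfect_size q h + min (q ^ h) (t - j * q ^ h)"
  shows "heap_count q (perfect_size q (Suc h) + t) = (\<Prod>j<q. Suc (heap_count q (x j)))"
    and "Suc (\<Sum>j<q. x j) = perfect_size q (Suc h) + t"
proof -
  have "heap_count q (x j) = level_count q h (min (q ^ h) (t - j * q ^ h))" for j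
    unfolding x_def by (rule heap_count_perfect_size_add) simp
  thus "heap_count q (perfect_size q (Suc h) + t) = (\<Prod>j<q. Suc (heap_count q (x j)))"
    using heap_count_perfect_size_add[OF assms(1)] by simp
  have "(\<Sum>j<q. x j) = q * perfect_size q h + t"
    unfolding x_def using assms(1) by (simp add: sum.distrib sum_children)
  thus "Suc (\<Sum>j<q. x j) = perfect_size q (Suc h) + t" by (simp add: perfect_size_Suc')
qed

text \<open>The numbers \<open>x i\<close> are the orders of the branches at a root, with 0 for a
  missing branch. With heaps for branches, no distribution beats the heap on all \<open>m\<close>
  vertices.\<close>

definition greedy_max :: "nat \<Rightarrow> bool" where
  "greedy_max m \<longleftrightarrow> (\<forall>x. Suc (\<Sum>i<q. x i) = m \<longrightarrow> (\<Prod>i<q. Suc (heap_count q (x i))) \<le> heap_count q m)"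

lemma level_count_one_partial:
  assumes "t \<le> q ^ h"
  shows "level_count q (Suc h) t = Suc (level_count q h t) * Suc (level_count q h 0) ^ (q - 1)"
proof -
  have "t - j * q ^ h = 0" if "j \<noteq> 0" for j
  proof -
    have "1 * q ^ h \<le> j * q ^ h" using that by (intro mult_right_mono) auto
    hence "t \<le> j * q ^ h" using assms by linarith
    thus ?thesis by simp
  qed
  hence "(\<Prod>j\<in>{..<q} - {0}. Suc (level_count q h (min (q ^ h) (t - j * q ^ h)))) = (\<Prod>j\<in>{..<q} - {0}. Suc (level_count q h 0))"
    by (intro prod.cong) auto
  thus ?thesis using assms by (simp add: prod.remove[of "{..<q}" 0])
qed

text \<open>If a child of the larger tree has more than \<open>b\<close> vertices, swap it with the smaller tree;
  otherwise redistribute the last levels between that child and the smaller tree.\<close>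

lemma exchange:
  assumes ab: "b < perfect_size q h" "perfect_size q h < a" "a \<le> perfect_size q (Suc h)"
    and max: "\<And>m. m < a \<Longrightarrow> greedy_max m"
  shows "\<exists>a' b'. a' + b' = a + b \<and>
    Suc (heap_count q a) * Suc (heap_count q b) < Suc (heap_count q a') * Suc (heap_count q b')"
proof -
  obtain g where h: "h = Suc g" using ab by (cases h) auto
  define t where "t = a - perfect_size q h"
  have a: "a = perfect_size q (Suc g) + t" "0 < t" "t \<le> q ^ Suc g"
    using ab by (auto simp: t_def h perfect_size_Suc)
  define x where "x j = perfect_size q g + min (q ^ g) (t - j * q ^ g)" for j
  have heap_count_a: "heap_count q a = (\<Prod>j<q. Suc (heap_count q (x j)))" and sum_x: "Suc (\<Sum>j<q. x j) = a"
    using heap_count_children[OF a(3)] by (simp_all add: a(1) x_def)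
  show ?thesis
  proof (cases "b < x 0")
    case True
    let ?R = "{..<q} - {0}" let ?P = "\<Prod>j\<in>?R. Suc (heap_count q (x j))"
    let ?a = "Suc (\<Sum>j<q. (x(0 := b)) j)"
    have "0 \<in> {..<q}" by simp
    note rem = prod.remove[OF finite_lessThan this] sum.remove[OF finite_lessThan this]
      prod_fun_upd[OF finite_lessThan this] sum_fun_upd[OF finite_lessThan this]
    have 1: "heap_count q a = Suc (heap_count q (x 0)) * ?P" unfolding heap_count_a by (rule rem(1))
    have s: "(\<Sum>j<q. x j) = x 0 + (\<Sum>j\<in>?R. x j)" "(\<Sum>j<q. (x(0 := b)) j) = b + (\<Sum>j\<in>?R. x j)"
      by (rule rem(2), rule rem(4))
    hence "?a < a" using True sum_x by simp
    hence "(\<Prod>j<q. Suc (heap_count q ((x(0 := b)) j))) \<le> heap_count q ?a"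
      using max[of ?a] unfolding greedy_max_def by blast
    hence 2: "Suc (heap_count q b) * ?P \<le> heap_count q ?a"
      unfolding rem(3)[where f = "\<lambda>y. Suc (heap_count q y)"] .
    \<comment> \<open>Both sides contain the product of \<open>?P\<close> with the factors of
      \<open>b\<close> and of \<open>x 0\<close>. What remains to compare is the factor of
      \<open>b\<close> against that of \<open>x 0\<close>.\<close>
    have "Suc (heap_count q a) * Suc (heap_count q b) < Suc (Suc (heap_count q b) * ?P) * Suc (heap_count q (x 0))"
      unfolding 1 using heap_count_strict_mono[OF True] by (simp add: algebra_simps)
    also have "\<dots> \<le> Suc (heap_count q ?a) * Suc (heap_count q (x 0))"
      using 2 by (intro mult_right_mono) auto
    finally show ?thesis using s sum_x by (intro exI[of _ ?a] exI[of _ "x 0"]) auto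
  next
    case False
    \<comment> \<open>As \<open>b\<close> is below a perfect size but at least \<open>x 0\<close>,
      the first child of the larger tree is not full. So its whole last level lies below that child,
      and the child and the smaller tree both have \<open>g\<close> complete levels, with
      \<open>t\<close> and \<open>s\<close> further vertices.\<close>
    let ?Q = "q ^ g" let ?P = "Suc_level_count g 0 ^ (q - 1)"
    define s where "s = b - perfect_size q g"
    have t: "t < ?Q" "t \<le> s" "s < ?Q" "b = perfect_size q g + s"
      using False ab(1) by (auto simp: x_def h perfect_size_Suc s_def)
    have level_count: "real (level_count q (Suc g) r) = Suc_level_count g r * ?P" if "r \<le> ?Q" for r
      using level_count_one_partial[OF that] by (simp add: Suc_level_count_def algebra_simps del: level_count.simps)
    have heap_count_big: "real (Suc (heap_count q (perfect_size q (Suc g) + r))) = 1 + Suc_level_count g r * ?P" if "r \<le> ?Q" for r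
    proof -
      have "?Q \<le> q ^ Suc g" using q2 by simp
      hence "heap_count q (perfect_size q (Suc g) + r) = level_count q (Suc g) r" using that by (intro heap_count_perfect_size_add) linarith
      thus ?thesis using level_count[OF that] by (simp del: level_count.simps)
    qed
    have heap_count_small: "real (Suc (heap_count q (perfect_size q g + r))) = Suc_level_count g r" if "r \<le> ?Q" for r
      using that by (simp add: heap_count_perfect_size_add Suc_level_count_def)
    have Suc_level_count_mono: "Suc_level_count g r < Suc_level_count g r'" if "r < r'" "r' \<le> ?Q" for r r'
      using level_count_strict_mono[OF that] by (simp add: Suc_level_count_def)
    \<comment> \<open>Expanded, each side is the factor of the smaller tree plus \<open>?P\<close>
      times a product of two factors. The product does not decrease by the exchange on level
      \<open>g\<close>; strictness comes from the smaller tree growing from \<open>s\<close> to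
      \<open>r'\<close>.\<close>
    have main: ?thesis if "r + r' = s + t" "s < r'" "r' \<le> ?Q" "Suc_level_count g s * Suc_level_count g t \<le> Suc_level_count g r' * Suc_level_count g r" for r r'
    proof (intro exI conjI)
      show "(perfect_size q (Suc g) + r) + (perfect_size q g + r') = a + b" using that(1) a(1) t(4) by simp
      have r: "r \<le> ?Q" using that t by linarith
      have "(1 + Suc_level_count g t * ?P) * Suc_level_count g s = Suc_level_count g s + (Suc_level_count g s * Suc_level_count g t) * ?P" by (simp add: algebra_simps)
      also have "\<dots> < Suc_level_count g r' + (Suc_level_count g r' * Suc_level_count g r) * ?P"
        using that Suc_level_count_mono by (intro add_less_le_mono mult_right_mono zero_le_power less_imp_le[OF Suc_level_count_pos(1)]) auto
      also have "\<dots> = (1 + Suc_level_count g r * ?P) * Suc_level_count g r'" by (simp add: algebra_simps)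
      finally have "real (Suc (heap_count q a) * Suc (heap_count q b)) <
          real (Suc (heap_count q (perfect_size q (Suc g) + r)) * Suc (heap_count q (perfect_size q g + r')))"
        unfolding of_nat_mult using t that(3) r a(1) by (simp only: heap_count_big heap_count_small less_imp_le)
      thus "Suc (heap_count q a) * Suc (heap_count q b) < Suc (heap_count q (perfect_size q (Suc g) + r)) * Suc (heap_count q (perfect_size q g + r'))"
        by (simp only: of_nat_less_iff)
    qed
    show ?thesis
    proof (cases "s + t \<le> ?Q")
      case True
      have "Suc_level_count g s * Suc_level_count g t \<le> Suc_level_count g (s + t) * Suc_level_count g 0"
        using level_exchange[of g] t True unfolding level_exchange_def by auto
      thus ?thesis using main[of 0 "s + t"] a(2) True by simp
    next
      case False
      have "Suc_level_count g s * Suc_level_count g t \<le> Suc_level_count g ?Q * Suc_level_count g (s + t - ?Q)"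
        using level_exchange[of g] t False unfolding level_exchange_def by auto
      thus ?thesis using main[of "s + t - ?Q" ?Q] t False by simp
    qed
  qed
qed

text \<open>With a common number of complete levels only the last levels matter. Merging them one
  branch after another by superadditivity yields the value of the heap exactly.\<close>

lemma greedy_max_level:
  assumes "\<And>i. i < q \<Longrightarrow> perfect_size q h \<le> x i \<and> x i \<le> perfect_size q (Suc h)"
  shows "(\<Prod>i<q. Suc (heap_count q (x i))) \<le> heap_count q (Suc (\<Sum>i<q. x i))"
proof -
  define t where "t i = x i - perfect_size q h" for i
  have t: "t i \<le> q ^ h" "x i = perfect_size q h + t i" if "i < q" for i
    using assms[OF that] by (auto simp: t_def perfect_size_Suc)
  have level_ratio: "Suc_level_count h (t i) = Suc_level_count h 0 * level_ratio h (t i)" if "i < q" for i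
    using level_ratio_step[of "t i" h 0] t(1)[OF that] by simp
  have superadd: "(\<Prod>i<N. level_ratio h (t i)) \<le> level_ratio h (\<Sum>i<N. t i)" for N
  proof (induction N)
    case (Suc N)
    have "(\<Prod>i<Suc N. level_ratio h (t i)) \<le> level_ratio h (\<Sum>i<N. t i) * level_ratio h (t N)"
      using Suc by (simp add: mult_right_mono less_imp_le)
    also have "\<dots> \<le> level_ratio h (\<Sum>i<Suc N. t i)"
      using level_ratio_superadd[OF level_exchange] by simp
    finally show ?case .
  qed simp
  have sum: "(\<Sum>i<q. x i) = q * perfect_size q h + (\<Sum>i<q. t i)"
    using t(2) by (simp add: sum.distrib)
  have le: "(\<Sum>i<q. t i) \<le> q ^ Suc h"
    using sum_bounded_above[of "{..<q}" t "q ^ h"] t(1) by simp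
  have "real (\<Prod>i<q. Suc (heap_count q (x i))) = (\<Prod>i<q. Suc_level_count h (t i))"
    unfolding of_nat_prod by (rule prod.cong) (simp_all add: t heap_count_perfect_size_add Suc_level_count_def)
  also have "\<dots> = Suc_level_count h 0 ^ q * (\<Prod>i<q. level_ratio h (t i))"
    using level_ratio by (simp add: prod.distrib)
  also have "\<dots> \<le> Suc_level_count h 0 ^ q * level_ratio h (\<Sum>i<q. t i)"
    using superadd by (intro mult_left_mono zero_le_power less_imp_le[OF Suc_level_count_pos(1)])
  also have "\<dots> = real (level_count q (Suc h) (\<Sum>i<q. t i))"
    using level_count_Suc_level_ratio[OF le] by simp
  also have "level_count q (Suc h) (\<Sum>i<q. t i) = heap_count q (Suc (\<Sum>i<q. x i))"
    using heap_count_perfect_size_add[OF le] by (simp add: sum perfect_size_Suc')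
  finally show ?thesis by (simp only: of_nat_le_iff)
qed

text \<open>Take a distribution with the largest product. By \<open>exchange\<close> no pair of its
  branches can be improved, so all orders lie in the window between consecutive perfect sizes that
  contains the largest one, and \<open>greedy_max_level\<close> applies. The induction serves the
  premise of \<open>exchange\<close> on smaller orders.\<close>

lemma greedy_max: "greedy_max m"
proof (induction m rule: less_induct)
  case (less m)
  let ?p = "\<lambda>x. \<Prod>i<q. Suc (heap_count q (x i))"
  show ?case unfolding greedy_max_def
  proof (intro allI impI)
    fix x0 :: "nat \<Rightarrow> nat" assume x0: "Suc (\<Sum>i<q. x0 i) = m"
    have "\<exists>x. Suc (\<Sum>i<q. x i) = m \<and> (\<forall>y. Suc (\<Sum>i<q. y i) = m \<longrightarrow> ?p y \<le> ?p x)"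
    proof (rule ex_has_greatest_nat)
      show "\<forall>y. Suc (\<Sum>i<q. y i) = m \<longrightarrow> ?p y < Suc (Suc (heap_count q m) ^ q)"
      proof (intro allI impI)
        fix y :: "nat \<Rightarrow> nat" assume y: "Suc (\<Sum>i<q. y i) = m"
        have "y i \<le> m" if "i < q" for i using member_le_sum[of i "{..<q}" y] that y by simp
        hence "?p y \<le> (\<Prod>i<q. Suc (heap_count q m))" by (intro prod_mono) (auto intro: heap_count_mono)
        thus "?p y < Suc (Suc (heap_count q m) ^ q)" by simp
      qed
    qed (fact x0)
    then obtain x where x: "Suc (\<Sum>i<q. x i) = m"
      and max: "\<And>y. Suc (\<Sum>i<q. y i) = m \<Longrightarrow> ?p y \<le> ?p x" by blast
    have no_gap: "perfect_size q h \<le> x j"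
      if ij: "i < q" "j < q" and xi: "perfect_size q h < x i" "x i \<le> perfect_size q (Suc h)" for i j h
    proof (rule ccontr)
      assume xj: "\<not> perfect_size q h \<le> x j"
      let ?R = "{..<q} - {i} - {j}"
      have "i \<noteq> j" using xi xj by auto
      have ij': "i \<in> {..<q}" "j \<in> {..<q} - {i}" using ij \<open>i \<noteq> j\<close> by auto
      have sum_split: "(\<Sum>k<q. y k) = y i + (y j + (\<Sum>k\<in>?R. y k))" for y :: "nat \<Rightarrow> nat"
        using sum.remove[OF _ ij'(1), of y] sum.remove[OF _ ij'(2), of y] by simp
      have prod_split: "?p y = Suc (heap_count q (y i)) * (Suc (heap_count q (y j)) * (\<Prod>k\<in>?R. Suc (heap_count q (y k))))"
        for y :: "nat \<Rightarrow> nat"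
        using prod.remove[OF _ ij'(1), of "\<lambda>k. Suc (heap_count q (y k))"]
          prod.remove[OF _ ij'(2), of "\<lambda>k. Suc (heap_count q (y k))"] by simp
      have "x i < m" using x unfolding sum_split by simp
      then obtain a b where ab: "a + b = x i + x j"
        "Suc (heap_count q (x i)) * Suc (heap_count q (x j)) < Suc (heap_count q a) * Suc (heap_count q b)"
        using exchange[of "x j" h "x i"] xi xj less by (metis less_trans not_le)
      let ?y = "x(i := a, j := b)"
      have y: "?y i = a" "?y j = b" using \<open>i \<noteq> j\<close> by auto
      have R: "(\<Sum>k\<in>?R. ?y k) = (\<Sum>k\<in>?R. x k)"
        "(\<Prod>k\<in>?R. Suc (heap_count q (?y k))) = (\<Prod>k\<in>?R. Suc (heap_count q (x k)))"
        by (auto intro!: sum.cong prod.cong)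
      have "?p ?y \<le> ?p x"
        using x ab(1) unfolding sum_split by (intro max) (simp only: sum_split y R)
      moreover have "?p x < ?p ?y"
      proof -
        have "0 < (\<Prod>k\<in>?R. Suc (heap_count q (x k)))" by (intro prod_pos) auto
        thus ?thesis using ab(2) unfolding prod_split y R
          by (simp only: mult.assoc[symmetric] mult_less_mono1)
      qed
      ultimately show False by simp
    qed
    have "?p x0 \<le> ?p x" using x0 by (rule max)
    also have "\<dots> \<le> heap_count q m"
    proof -
      define M where "M = Max (x ` {..<q})"
      have "M \<in> x ` {..<q}" unfolding M_def using q2 by (intro Max_in) (auto simp: lessThan_empty_iff)
      then obtain i where i: "i < q" "x i = M" by auto
      have le: "x j \<le> M" if "j < q" for j unfolding M_def using that by simp
      obtain h where lvl: "\<And>j. j < q \<Longrightarrow> perfect_size q h \<le> x j \<and> x j \<le> perfect_size q (Suc h)"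
      proof (cases "M = 0")
        case True
        thus ?thesis using le that[of 0] by simp
      next
        case False
        then obtain h where "perfect_size q h < M" "M \<le> perfect_size q (Suc h)" using perfect_size_bracket[of M] by auto
        thus ?thesis using no_gap[OF i(1), of _ h] i(2) le that[of h] by (meson order_trans)
      qed
      show ?thesis using greedy_max_level[of h x, OF lvl] x by simp
    qed
    finally show "?p x0 \<le> heap_count q m" .
  qed
qed

lemma heap_count_ge_prod: "(\<Prod>i<q. Suc (heap_count q (x i))) \<le> heap_count q (Suc (\<Sum>i<q. x i))"
  using greedy_max unfolding greedy_max_def by blast

text \<open>A gap of 2 leaves room for two path lengths of different parity with the same
  \<open>n_prime\<close>. It arises by enlarging one branch while another is nonempty: the gain is
  at least the product of the other factors, which is at least 2.\<close>

lemma heap_count_Suc_gap: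
  assumes "2 \<le> m"
  shows "heap_count q m + 2 \<le> heap_count q (Suc m)"
proof -
  obtain h where h: "perfect_size q h < m" "m \<le> perfect_size q (Suc h)" using perfect_size_bracket[of m] assms by auto
  have "h \<noteq> 0" using h assms by (cases h) (auto simp: perfect_size_Suc)
  then obtain g where g: "h = Suc g" by (cases h) auto
  obtain x where x: "heap_count q m = (\<Prod>j<q. Suc (heap_count q (x j)))" "Suc (\<Sum>j<q. x j) = m"
    using heap_count_children[of "m - perfect_size q h" g] h unfolding g perfect_size_Suc[of _ "Suc g"] by force
  have "\<exists>j<q. x j \<noteq> 0" using x(2) assms by (intro ccontr[of "\<exists>j<q. x j \<noteq> 0"]) simp
  then obtain j where j: "j < q" "x j \<noteq> 0" by blast
  define i where "i = (if j = 0 then 1 else 0 :: nat)"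
  have i: "i < q" "i \<noteq> j" using q2 by (auto simp: i_def)
  let ?y = "x(i := Suc (x i))" let ?R = "{..<q} - {i}"
  let ?P = "\<Prod>k\<in>?R. Suc (heap_count q (x k))"
  have iq: "i \<in> {..<q}" using i by simp
  have sum: "(\<Sum>k<q. ?y k) = m"
    using x(2) sum.remove[OF _ iq, of x] sum_fun_upd[OF _ iq, of x "Suc (x i)"] by simp
  have "Suc (heap_count q (Suc (x i))) * ?P \<le> heap_count q (Suc m)"
    using heap_count_ge_prod[of ?y] unfolding sum prod_fun_upd[OF finite_lessThan iq, where f = "\<lambda>y. Suc (heap_count q y)"] .
  moreover have "heap_count q m = Suc (heap_count q (x i)) * ?P"
    unfolding x(1) by (rule prod.remove[OF finite_lessThan iq])
  moreover have "Suc (Suc (heap_count q (x i))) * ?P \<le> Suc (heap_count q (Suc (x i))) * ?P"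
    using heap_count_strict_mono[of "x i" "Suc (x i)"] by (intro mult_right_mono) auto
  moreover have "2 \<le> ?P"
  proof -
    have "?P = Suc (heap_count q (x j)) * (\<Prod>k\<in>?R - {j}. Suc (heap_count q (x k)))"
      by (rule prod.remove) (use i j in auto)
    moreover have "0 < (\<Prod>k\<in>?R - {j}. Suc (heap_count q (x k)))" by (rule prod_pos) simp
    ultimately have "Suc (heap_count q (x j)) \<le> ?P"
      by (metis Suc_leI One_nat_def mult.right_neutral mult_le_mono2)
    thus ?thesis using j heap_count_ge[of "x j"] by simp
  qed
  ultimately show ?thesis by simp
qed

end

section \<open>Connected sets in a tree\<close>

definition adj :: "'a set set \<Rightarrow> 'a set \<Rightarrow> ('a \<times> 'a) set" where
  "adj E S = {(x, y). x \<in> S \<and> y \<in> S \<and> {x, y} \<in> E}"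

definition connected_in :: "'a set set \<Rightarrow> 'a set \<Rightarrow> bool" where
  "connected_in E S \<longleftrightarrow> (\<forall>x\<in>S. \<forall>y\<in>S. (x, y) \<in> (adj E S)\<^sup>*)"

text \<open>Acyclicity in relational form: deleting an edge separates its ends. In particular there
  are no loops, since reachability is reflexive.\<close>

definition bridges :: "'a set set \<Rightarrow> 'a set \<Rightarrow> bool" where
  "bridges E V \<longleftrightarrow> (\<forall>x y. {x, y} \<in> E \<longrightarrow> (x, y) \<notin> (adj E V - {(x, y), (y, x)})\<^sup>*)"

text \<open>\<open>A\<close> and \<open>B\<close> are the two sides of the edge \<open>{x, y}\<close> in the tree on \<open>A \<union> B\<close>.\<close>

definition edge_split :: "'a set set \<Rightarrow> 'a \<Rightarrow> 'a \<Rightarrow> 'a set \<Rightarrow> 'a set \<Rightarrow> bool" where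
  "edge_split E x y A B \<longleftrightarrow> x \<in> A \<and> y \<in> B \<and> A \<inter> B = {} \<and> connected_in E A \<and> connected_in E B \<and> {x, y} \<in> E \<and>
     (\<forall>a\<in>A. \<forall>b\<in>B. {a, b} \<in> E \<longrightarrow> a = x \<and> b = y)"

definition num_connected :: "'a set set \<Rightarrow> 'a set \<Rightarrow> 'a \<Rightarrow> nat" where
  "num_connected E S v = card {U. U \<subseteq> S \<and> v \<in> U \<and> connected_in E U}"

definition deg_in :: "'a set set \<Rightarrow> 'a set \<Rightarrow> 'a \<Rightarrow> nat" where
  "deg_in E S v = card {w \<in> S. {v, w} \<in> E}"

lemma adj_mono: "S \<subseteq> S' \<Longrightarrow> adj E S \<subseteq> adj E S'"
  by (auto simp: adj_def)

lemma sym_adj: "sym (adj E S)"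
  by (auto simp: adj_def sym_def insert_commute)

lemma connected_in_rootI:
  assumes "\<And>z. z \<in> S \<Longrightarrow> (r, z) \<in> (adj E S)\<^sup>*"
  shows "connected_in E S"
  unfolding connected_in_def
proof (intro ballI)
  fix x y assume "x \<in> S" "y \<in> S"
  hence "(r, x) \<in> (adj E S)\<^sup>*" "(r, y) \<in> (adj E S)\<^sup>*" using assms by auto
  thus "(x, y) \<in> (adj E S)\<^sup>*"
    using sym_rtrancl[OF sym_adj, of E S] by (meson rtrancl_trans symD)
qed

lemma connected_in_singleton [simp]: "connected_in E {x}"
  by (rule connected_in_rootI[of _ x]) auto

lemma connected_in_join:
  assumes "connected_in E A" "connected_in E B" "x \<in> A" "y \<in> B" "{x, y} \<in> E"
  shows "connected_in E (A \<union> B)"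
proof (rule connected_in_rootI[of _ x])
  have A: "(adj E A)\<^sup>* \<subseteq> (adj E (A \<union> B))\<^sup>*" and B: "(adj E B)\<^sup>* \<subseteq> (adj E (A \<union> B))\<^sup>*"
    by (intro rtrancl_mono adj_mono; simp)+
  have xy: "(x, y) \<in> adj E (A \<union> B)" using assms by (auto simp: adj_def)
  fix z assume "z \<in> A \<union> B"
  thus "(x, z) \<in> (adj E (A \<union> B))\<^sup>*"
  proof
    assume "z \<in> A"
    thus ?thesis using assms A unfolding connected_in_def by blast
  next
    assume "z \<in> B"
    hence "(y, z) \<in> (adj E (A \<union> B))\<^sup>*" using assms B unfolding connected_in_def by blast
    thus ?thesis using xy by (rule converse_rtrancl_into_rtrancl[rotated])
  qed
qed

lemma edge_split_sym: "edge_split E x y A B \<Longrightarrow> edge_split E y x B A"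
  unfolding edge_split_def by (auto simp: insert_commute)

text \<open>Collapse \<open>B\<close> to the vertex \<open>x\<close>. A path inside \<open>U\<close>
  is mapped to one inside \<open>U \<inter> A\<close>, because the only edge between the sides
  leaves \<open>A\<close> at \<open>x\<close>.\<close>

lemma edge_split_conn_inter:
  assumes sp: "edge_split E x y A B" and U: "U \<subseteq> A \<union> B" "x \<in> U" "connected_in E U"
  shows "connected_in E (U \<inter> A)"
proof (rule connected_in_rootI[of _ x])
  define \<pi> where "\<pi> w = (if w \<in> A then w else x)" for w
  fix z assume z: "z \<in> U \<inter> A"
  have "(x, z) \<in> (adj E U)\<^sup>*" using U z by (auto simp: connected_in_def)
  hence "(\<pi> x, \<pi> z) \<in> (adj E (U \<inter> A))\<^sup>*"
  proof induction
    case (step w w')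
    have w: "w \<in> U" "w' \<in> U" "{w, w'} \<in> E" "{w', w} \<in> E"
      using step(2) by (auto simp: adj_def insert_commute)
    have "\<pi> w = \<pi> w' \<or> (\<pi> w, \<pi> w') \<in> adj E (U \<inter> A)"
    proof (cases "w \<in> A"; cases "w' \<in> A")
      assume "w \<in> A" "w' \<notin> A"
      hence "w = x" using w sp U(1) unfolding edge_split_def by blast
      thus ?thesis using \<open>w' \<notin> A\<close> by (simp add: \<pi>_def)
    next
      assume "w \<notin> A" "w' \<in> A"
      hence "w' = x" using w sp U(1) unfolding edge_split_def by blast
      thus ?thesis using \<open>w \<notin> A\<close> by (simp add: \<pi>_def)
    qed (use w in \<open>auto simp: adj_def \<pi>_def\<close>)
    thus ?case using step(3) by (metis rtrancl.rtrancl_into_rtrancl)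
  qed simp
  thus "(x, z) \<in> (adj E (U \<inter> A))\<^sup>*" using z sp by (auto simp: \<pi>_def edge_split_def)
qed

lemma edge_split_crosses:
  assumes sp: "edge_split E x y A B" and U: "U \<subseteq> A \<union> B" "x \<in> U" "connected_in E U" "z \<in> U \<inter> B"
  shows "y \<in> U"
proof (rule ccontr)
  assume y: "y \<notin> U"
  have "(x, z) \<in> (adj E U)\<^sup>*" using U by (auto simp: connected_in_def)
  hence "z \<in> A"
  proof induction
    case (step w w')
    thus ?case using sp U y unfolding edge_split_def adj_def by auto
  qed (use sp in \<open>auto simp: edge_split_def\<close>)
  thus False using U(4) sp by (auto simp: edge_split_def)
qed

text \<open>A connected set through \<open>x\<close> is given by its two traces. The one on
  \<open>B\<close> is either empty, which accounts for the \<open>Suc\<close>, or a connected set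
  through \<open>y\<close>.\<close>

lemma num_connected_split:
  assumes sp: "edge_split E x y A B" and fin: "finite A" "finite B"
  shows "num_connected E (A \<union> B) x = num_connected E A x * Suc (num_connected E B y)"
proof -
  let ?C = "\<lambda>S v. {U. U \<subseteq> S \<and> v \<in> U \<and> connected_in E U}"
  have disj: "A \<inter> B = {}" and xy: "x \<in> A" "y \<in> B" "{x, y} \<in> E" using sp by (auto simp: edge_split_def)
  have "bij_betw (\<lambda>U. (U \<inter> A, U \<inter> B)) (?C (A \<union> B) x) (?C A x \<times> insert {} (?C B y))"
  proof (rule bij_betw_byWitness[where f' = "\<lambda>(U, W). U \<union> W"])
    show "(\<lambda>U. (U \<inter> A, U \<inter> B)) ` ?C (A \<union> B) x \<subseteq> ?C A x \<times> insert {} (?C B y)"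
    proof (rule image_subsetI)
      fix U assume U: "U \<in> ?C (A \<union> B) x"
      have 1: "U \<inter> A \<in> ?C A x" using edge_split_conn_inter[OF sp] U xy by auto
      have 2: "U \<inter> B \<in> ?C B y" if "z \<in> U \<inter> B" for z
      proof -
        have "y \<in> U" using edge_split_crosses[OF sp] U that by auto
        thus ?thesis using edge_split_conn_inter[OF edge_split_sym[OF sp]] U xy by auto
      qed
      show "(U \<inter> A, U \<inter> B) \<in> ?C A x \<times> insert {} (?C B y)" using 1 2 by blast
    qed
    show "(\<lambda>(U, W). U \<union> W) ` (?C A x \<times> insert {} (?C B y)) \<subseteq> ?C (A \<union> B) x"
      using xy by (auto intro: connected_in_join)
  qed (use disj in auto)
  hence "card (?C (A \<union> B) x) = card (?C A x) * card (insert {} (?C B y))"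
    by (simp add: bij_betw_same_card card_cartesian_product)
  moreover have "finite (?C B y)" using fin by simp
  ultimately show ?thesis by (simp add: num_connected_def)
qed

lemma deg_in_split:
  assumes "edge_split E x y A B" "finite A" "finite B"
  shows "deg_in E (A \<union> B) x = Suc (deg_in E A x)"
    and "z \<in> A \<Longrightarrow> z \<noteq> x \<Longrightarrow> deg_in E (A \<union> B) z = deg_in E A z"
proof -
  have "{w \<in> A \<union> B. {x, w} \<in> E} = insert y {w \<in> A. {x, w} \<in> E}" "y \<notin> A"
    using assms unfolding edge_split_def by auto
  thus "deg_in E (A \<union> B) x = Suc (deg_in E A x)" using assms by (simp add: deg_in_def)
  assume "z \<in> A" "z \<noteq> x"
  hence "{w \<in> A \<union> B. {z, w} \<in> E} = {w \<in> A. {z, w} \<in> E}"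
    using assms unfolding edge_split_def by auto
  thus "deg_in E (A \<union> B) z = deg_in E A z" by (simp add: deg_in_def)
qed

text \<open>The sides are the sets reachable from \<open>x\<close> and from \<open>y\<close> inside
  \<open>S\<close> without the edge. They are disjoint because a detour inside \<open>S\<close>
  would be one inside \<open>V\<close>.\<close>

lemma edge_split_exists:
  assumes br: "bridges E V" and S: "connected_in E S" "S \<subseteq> V" "x \<in> S" "y \<in> S" and e: "{x, y} \<in> E"
  obtains A B where "edge_split E x y A B" "A \<union> B = S"
proof -
  let ?r = "adj E S - {(x, y), (y, x)}"
  define A where "A = {z \<in> S. (x, z) \<in> ?r\<^sup>*}"
  define B where "B = {z \<in> S. (y, z) \<in> ?r\<^sup>*}"
  have "?r \<subseteq> adj E V - {(x, y), (y, x)}" using adj_mono[OF S(2)] by blast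
  hence nxy: "(x, y) \<notin> ?r\<^sup>*" using br e rtrancl_mono unfolding bridges_def by blast
  have "sym ?r" using sym_adj[of E S] unfolding sym_def by blast
  hence sym: "(a, b) \<in> ?r\<^sup>* \<Longrightarrow> (b, a) \<in> ?r\<^sup>*" for a b by (meson sym_rtrancl symD)
  have connected_in: "connected_in E {z \<in> S. (a, z) \<in> ?r\<^sup>*}" (is "connected_in E ?S") if "a \<in> S" for a
  proof (rule connected_in_rootI[of _ a])
    fix z assume z: "z \<in> ?S"
    hence "(a, z) \<in> ?r\<^sup>*" by simp
    thus "(a, z) \<in> (adj E ?S)\<^sup>*"
    proof induction
      case (step w w')
      have "(w, w') \<in> adj E ?S" using step(1,2) unfolding adj_def by (auto intro: rtrancl_into_rtrancl)
      thus ?case using step(3) by (rule rtrancl_into_rtrancl[rotated])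
    qed simp
  qed
  have disj: "A \<inter> B = {}" 
  proof (rule equals0I)
    fix z assume "z \<in> A \<inter> B"
    hence "(x, z) \<in> ?r\<^sup>*" "(z, y) \<in> ?r\<^sup>*" using sym unfolding A_def B_def by blast+
    thus False using nxy by (meson rtrancl_trans)
  qed
  have un: "A \<union> B = S"
  proof
    show "S \<subseteq> A \<union> B"
    proof
      fix z assume "z \<in> S"
      hence "(x, z) \<in> (adj E S)\<^sup>*" using S by (auto simp: connected_in_def)
      thus "z \<in> A \<union> B"
      proof induction
        case (step w w')
        have w': "w' \<in> S" using step(2) by (auto simp: adj_def)
        show ?case
        proof (cases "(w, w') \<in> ?r")
          case True
          thus ?thesis using step(3) w' unfolding A_def B_def by (auto intro: rtrancl_into_rtrancl)
        next
          case False
          hence "w' = x \<or> w' = y" using step(2) by auto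
          thus ?thesis using S unfolding A_def B_def by auto
        qed
      qed (use S in \<open>auto simp: A_def\<close>)
    qed
  qed (auto simp: A_def B_def)
  have cross: "a = x \<and> b = y" if "a \<in> A" "b \<in> B" "{a, b} \<in> E" for a b
  proof (rule ccontr)
    assume "\<not> (a = x \<and> b = y)"
    moreover have "\<not> (a = y \<and> b = x)"
      using that(1) nxy unfolding A_def by blast
    ultimately have "(a, b) \<in> ?r" using that by (auto simp: adj_def A_def B_def)
    moreover have "(x, a) \<in> ?r\<^sup>*" using that(1) unfolding A_def by blast
    ultimately have "(x, b) \<in> ?r\<^sup>*" by (rule rtrancl_into_rtrancl[rotated])
    hence "b \<in> A" using that unfolding A_def B_def by blast
    thus False using disj that by auto
  qed
  have "connected_in E A" "connected_in E B" "x \<in> A" "y \<in> B"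
    unfolding A_def B_def using connected_in S by blast+
  hence "edge_split E x y A B" unfolding edge_split_def
    using disj e cross by blast
  thus ?thesis using un that by blast
qed

text \<open>Induction over rooted trees: cut an edge from the root \<open>x\<close> to a neighbour
  \<open>y\<close>. The side \<open>A\<close> keeps the root, the side \<open>B\<close> is a whole
  branch rooted at \<open>y\<close>, and both are smaller.\<close>

lemma connected_in_root_induct [consumes 5, case_names single join]:
  assumes "bridges E V" "S \<subseteq> V" "finite S" "connected_in E S" "r \<in> S"
    and single: "\<And>x. x \<in> S \<Longrightarrow> P {x} x"
    and join: "\<And>A B x y. edge_split E x y A B \<Longrightarrow> A \<union> B \<subseteq> S \<Longrightarrow> finite A \<Longrightarrow> finite B \<Longrightarrow> P A x \<Longrightarrow> P B y \<Longrightarrow> P (A \<union> B) x"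
  shows "P S r"
proof -
  have "P U r" if "U \<subseteq> S" "connected_in E U" "r \<in> U" for U r
    using that
  proof (induction "card U" arbitrary: U r rule: less_induct)
    case less
    have finU: "finite U" using less.prems assms finite_subset by blast
    show ?case
    proof (cases "U = {r}")
      case True
      thus ?thesis using single less.prems by auto
    next
      case False
      then obtain z where z: "z \<in> U" "z \<noteq> r" using less.prems by auto
      hence "(r, z) \<in> (adj E U)\<^sup>*" using less.prems by (auto simp: connected_in_def)
      then obtain y where "(r, y) \<in> adj E U" using z(2) by (cases rule: converse_rtranclE) auto
      hence y: "y \<in> U" "{r, y} \<in> E" by (auto simp: adj_def)
      obtain A B where AB: "edge_split E r y A B" "A \<union> B = U"
        using edge_split_exists[OF assms(1) less.prems(2) _ less.prems(3) y] less.prems assms by blast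
      have AB': "r \<in> A" "y \<in> B" "A \<inter> B = {}" "connected_in E A" "connected_in E B" using AB by (auto simp: edge_split_def)
      have "A \<subset> U" "B \<subset> U" using AB AB' by blast+
      hence "card A < card U" "card B < card U" using finU by (auto intro: psubset_card_mono)
      hence "P A r" "P B y" using less.hyps AB' AB less.prems by auto
      thus ?thesis using join[OF AB(1)] AB less.prems finU by (metis finite_Un)
    qed
  qed
  thus ?thesis using assms by blast
qed

section \<open>Translation of walks, degrees and distances into these terms\<close>

lemma walk_iff:
  "walk G p \<longleftrightarrow> p \<noteq> [] \<and> set p \<subseteq> verts G \<and> successively (\<lambda>x y. {x, y} \<in> edges G) p"
  by (simp add: walk_def successively_conv_nth)

lemma successively_rtrancl:
  "successively (\<lambda>a b. (a, b) \<in> r) p \<Longrightarrow> p \<noteq> [] \<Longrightarrow> (hd p, last p) \<in> r\<^sup>*"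
proof (induction p rule: induct_list012)
  case (3 x y zs)
  thus ?case by (auto intro: converse_rtrancl_into_rtrancl)
qed auto

lemma rtrancl_distinct_path:
  assumes "(x, y) \<in> r\<^sup>*"
  shows "\<exists>p. p \<noteq> [] \<and> hd p = x \<and> last p = y \<and> distinct p \<and>
    successively (\<lambda>a b. (a, b) \<in> r) p \<and> set p \<subseteq> insert x (Range r)"
  using assms
proof induction
  case base
  show ?case by (intro exI[of _ "[x]"]) simp
next
  case (step y z)
  then obtain p where p: "p \<noteq> []" "hd p = x" "last p = y" "distinct p"
    "successively (\<lambda>a b. (a, b) \<in> r) p" "set p \<subseteq> insert x (Range r)" by blast
  show ?case
  proof (cases "z \<in> set p")
    \<comment> \<open>A vertex that already occurs closes a loop; the path is cut back to its
      earlier occurrence.\<close>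
    case True
    then obtain p1 p2 where p12: "p = p1 @ z # p2" by (meson split_list)
    have "successively (\<lambda>a b. (a, b) \<in> r) ((p1 @ [z]) @ p2)" using p(5) p12 by simp
    hence "successively (\<lambda>a b. (a, b) \<in> r) (p1 @ [z])" unfolding successively_append_iff by blast
    moreover have "hd (p1 @ [z]) = x" using p(2) p12 by (cases p1) auto
    ultimately show ?thesis using p p12 by (intro exI[of _ "p1 @ [z]"]) auto
  next
    case False
    thus ?thesis using p step(2) by (intro exI[of _ "p @ [z]"]) (auto simp: successively_append_iff)
  qed
qed

lemma walk_rtrancl: "walk G p \<Longrightarrow> (hd p, last p) \<in> (adj (edges G) (verts G))\<^sup>*"
proof (rule successively_rtrancl)
  assume "walk G p"
  hence "successively (\<lambda>x y. {x, y} \<in> edges G) p" "set p \<subseteq> verts G" by (simp_all add: walk_iff)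
  thus "successively (\<lambda>a b. (a, b) \<in> adj (edges G) (verts G)) p"
    by (auto simp: adj_def elim!: successively_mono)
qed (simp add: walk_iff)

lemma adj_path_between:
  assumes "(u, v) \<in> (adj (edges G) S)\<^sup>*" "S \<subseteq> verts G" "u \<in> S"
  shows "\<exists>p. path_between G u v p \<and> set p \<subseteq> S"
proof -
  obtain p where p: "p \<noteq> []" "hd p = u" "last p = v" "distinct p"
    "successively (\<lambda>a b. (a, b) \<in> adj (edges G) S) p" "set p \<subseteq> insert u (Range (adj (edges G) S))"
    using rtrancl_distinct_path[OF assms(1)] by blast
  have "set p \<subseteq> S" using p(6) assms(3) by (auto simp: adj_def)
  moreover have "successively (\<lambda>x y. {x, y} \<in> edges G) p"
    using p(5) by (rule successively_mono) (auto simp: adj_def)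
  ultimately show ?thesis using p assms(2) by (auto simp: path_between_def walk_iff)
qed

lemma connected_graph_iff: "connected_graph G \<longleftrightarrow> verts G \<noteq> {} \<and> connected_in (edges G) (verts G)"
proof -
  have "(\<exists>p. walk G p \<and> hd p = u \<and> last p = v) \<longleftrightarrow> (u, v) \<in> (adj (edges G) (verts G))\<^sup>*"
    if "u \<in> verts G" for u v
    using walk_rtrancl[of G] adj_path_between[of u v G "verts G"] that
    unfolding path_between_def by (metis order_refl)
  thus ?thesis unfolding connected_graph_def connected_in_def by blast
qed

lemma connected_induced: "connected_graph (induced G S) \<longleftrightarrow> S \<noteq> {} \<and> connected_in (edges G) S"
proof -
  have "adj (edges (induced G S)) S = adj (edges G) S"
    by (auto simp: adj_def induced_def)
  thus ?thesis unfolding connected_graph_iff by (simp add: induced_def connected_in_def)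
qed

lemma num_subtrees_at_conv:
  assumes "v \<in> verts G"
  shows "num_subtrees_at G v = num_connected (edges G) (verts G) v"
proof -
  have "{S \<in> subtrees G. v \<in> S} = {U. U \<subseteq> verts G \<and> v \<in> U \<and> connected_in (edges G) U}"
    by (auto simp: subtrees_def connected_induced)
  thus ?thesis by (simp add: num_subtrees_at_def num_connected_def)
qed

lemma degree_conv:
  assumes "simple_graph G" "v \<in> verts G"
  shows "degree G v = deg_in (edges G) (verts G) v"
proof -
  have "bij_betw (\<lambda>w. {v, w}) {w \<in> verts G. {v, w} \<in> edges G} {e \<in> edges G. v \<in> e}"
    unfolding bij_betw_def
  proof
    show "inj_on (\<lambda>w. {v, w}) {w \<in> verts G. {v, w} \<in> edges G}"
      by (auto simp: inj_on_def doubleton_eq_iff)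
    show "(\<lambda>w. {v, w}) ` {w \<in> verts G. {v, w} \<in> edges G} = {e \<in> edges G. v \<in> e}"
    proof
      show "{e \<in> edges G. v \<in> e} \<subseteq> (\<lambda>w. {v, w}) ` {w \<in> verts G. {v, w} \<in> edges G}"
      proof
        fix e assume e: "e \<in> {e \<in> edges G. v \<in> e}"
        then obtain a b where "a \<in> verts G" "b \<in> verts G" "e = {a, b}"
          using assms by (auto simp: simple_graph_def)
        thus "e \<in> (\<lambda>w. {v, w}) ` {w \<in> verts G. {v, w} \<in> edges G}"
          using e by (auto simp: insert_commute)
      qed
    qed auto
  qed
  thus ?thesis by (simp add: degree_def deg_in_def bij_betw_same_card)
qed

text \<open>A detour around an edge can be chosen without repetitions. It has at least three
  vertices, since the edge itself is excluded, so the edge closes it to a cycle.\<close>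

lemma tree_bridges:
  assumes "is_tree T"
  shows "bridges (edges T) (verts T)"
  unfolding bridges_def
proof (intro allI impI notI)
  let ?E = "edges T" let ?V = "verts T"
  fix x y assume e: "{x, y} \<in> ?E" and r: "(x, y) \<in> (adj ?E ?V - {(x, y), (y, x)})\<^sup>*"
  let ?r = "adj ?E ?V - {(x, y), (y, x)}"
  have "simple_graph T" using assms by (simp add: is_tree_def)
  hence xy: "x \<in> ?V" "y \<in> ?V" "x \<noteq> y" using e unfolding simple_graph_def
    by (metis doubleton_eq_iff)+
  obtain p where p: "p \<noteq> []" "hd p = x" "last p = y" "distinct p"
    "successively (\<lambda>a b. (a, b) \<in> ?r) p" "set p \<subseteq> insert x (Range ?r)"
    using rtrancl_distinct_path[OF r] by blast
  have "Range ?r \<subseteq> ?V" by (auto simp: adj_def)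
  hence "set p \<subseteq> ?V" using p(6) xy(1) by blast
  moreover have "successively (\<lambda>x y. {x, y} \<in> ?E) p"
    using p(5) by (rule successively_mono) (auto simp: adj_def)
  ultimately have "walk T (p @ [hd p])" using p e xy
    by (auto simp: walk_iff successively_append_iff insert_commute)
  moreover have "3 \<le> length p"
  proof (rule ccontr)
    assume "\<not> 3 \<le> length p"
    then consider a where "p = [a]" | a b where "p = [a, b]"
      using p(1) by (cases p rule: remdups_adj.cases) (auto simp: numeral_3_eq_3 Suc_le_eq)
    thus False using p xy by cases auto
  qed
  ultimately show False using p assms unfolding is_tree_def cycle_def by blast
qed

text \<open>If the paths continue from \<open>u\<close> to different vertices \<open>a\<close> and
  \<open>b\<close>, their remainders avoid \<open>u\<close>. Then \<open>u\<close>,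
  \<open>b\<close>, \<open>v\<close>, \<open>a\<close> are joined in this order without the edge
  from \<open>u\<close> to \<open>a\<close>, which is a bridge.\<close>

lemma path_unique:
  assumes "bridges (edges T) (verts T)"
  shows "path_between T u v p \<Longrightarrow> path_between T u v p' \<Longrightarrow> p = p'"
proof (induction p arbitrary: u p')
  case Nil
  thus ?case by (simp add: path_between_def walk_def)
next
  case (Cons u0 p)
  have u0: "u0 = u" using Cons.prems by (simp add: path_between_def)
  obtain p'' where p'': "p' = u # p''"
    using Cons.prems by (cases p') (auto simp: path_between_def walk_def)
  have nin: "u \<notin> set p" "u \<notin> set p''" using Cons.prems u0 p'' by (auto simp: path_between_def)
  show ?case
  proof (cases "u = v")
    case True
    hence "p = []" "p'' = []"
      using Cons.prems nin unfolding u0 p'' path_between_def by (auto split: if_splits)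
    thus ?thesis using u0 p'' by simp
  next
    case False
    then obtain a ps b ps' where ab: "p = a # ps" "p'' = b # ps'"
      using Cons.prems unfolding u0 p'' path_between_def by (cases p; cases p'') auto
    have paths: "path_between T a v p" "path_between T b v p''"
      using Cons.prems unfolding u0 p'' ab path_between_def walk_iff by auto
    have edges: "{u, a} \<in> edges T" "{u, b} \<in> edges T"
      and V: "u \<in> verts T" "a \<in> verts T" "b \<in> verts T"
      using Cons.prems unfolding u0 p'' ab path_between_def walk_iff by auto
    show ?thesis
    proof (cases "a = b")
      case True
      thus ?thesis using Cons.IH[OF paths(1)] paths(2) u0 p'' by simp
    next
      case ne: False
      let ?r = "adj (edges T) (verts T) - {(u, a), (a, u)}"
      have tail: "(hd s, v) \<in> ?r\<^sup>*" if s: "path_between T (hd s) v s" "u \<notin> set s" for s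
      proof -
        have "successively (\<lambda>x y. (x, y) \<in> ?r) s"
          using s unfolding path_between_def walk_iff
          by (auto simp: adj_def elim!: successively_mono)
        thus ?thesis using successively_rtrancl[of ?r s] s by (auto simp: path_between_def walk_def)
      qed
      have sym: "sym ?r" using sym_adj[of "edges T" "verts T"] unfolding sym_def by blast
      have "(a, v) \<in> ?r\<^sup>*" "(b, v) \<in> ?r\<^sup>*"
        using tail[of p] tail[of p''] paths nin ab by auto
      moreover have "(u, b) \<in> ?r" using edges V ne nin ab by (auto simp: adj_def)
      ultimately have "(u, a) \<in> ?r\<^sup>*"
        using sym_rtrancl[OF sym] by (meson converse_rtrancl_into_rtrancl rtrancl_trans symD)
      thus ?thesis using assms edges unfolding bridges_def by blast
    qed
  qed
qed

lemma tdist_eq: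
  assumes "is_tree T" "path_between T u v p"
  shows "tdist T u v = length p - 1"
proof -
  have "(THE p. path_between T u v p) = p"
    using assms path_unique[OF tree_bridges[OF assms(1)]] by blast
  thus ?thesis by (simp add: tdist_def)
qed

lemma connected_in_path:
  assumes "connected_in (edges G) S" "S \<subseteq> verts G" "u \<in> S" "v \<in> S"
  obtains p where "path_between G u v p" "set p \<subseteq> S"
  using adj_path_between[of u v G S] assms unfolding connected_in_def by blast

lemma tdist_less_card:
  assumes "is_tree T" "connected_in (edges T) S" "S \<subseteq> verts T" "u \<in> S" "v \<in> S"
  shows "tdist T u v < card S"
proof -
  obtain p where p: "path_between T u v p" "set p \<subseteq> S" using connected_in_path assms by metis
  have "finite S" using assms finite_subset by (auto simp: is_tree_def simple_graph_def)
  hence "length p \<le> card S"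
    using p by (metis card_mono distinct_card path_between_def)
  moreover have "p \<noteq> []" using p by (auto simp: path_between_def walk_def)
  ultimately show ?thesis using tdist_eq[OF assms(1) p(1)] by (cases p) auto
qed

lemma path_between_rev: "path_between G u v p \<Longrightarrow> path_between G v u (rev p)"
  by (auto simp: path_between_def walk_iff hd_rev last_rev insert_commute)

lemma path_between_append:
  assumes "path_between G u x p" "path_between G y v p'" "{x, y} \<in> edges G" "set p \<inter> set p' = {}"
  shows "path_between G u v (p @ p')"
  using assms by (auto simp: path_between_def walk_iff successively_append_iff)

lemma tdist_commute:
  assumes "is_tree T" "u \<in> verts T" "v \<in> verts T"
  shows "tdist T u v = tdist T v u"
proof -
  have "connected_in (edges T) (verts T)" using assms by (simp add: is_tree_def connected_graph_iff)
  then obtain p where p: "path_between T u v p" using connected_in_path assms by (metis order_refl)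
  show ?thesis using tdist_eq[OF assms(1) p] tdist_eq[OF assms(1) path_between_rev[OF p]] by simp
qed

lemma tdist_split:
  assumes T: "is_tree T" and sp: "edge_split (edges T) x y A B" and V: "A \<union> B \<subseteq> verts T"
    and "a \<in> A" "b \<in> B"
  shows "tdist T a b = Suc (tdist T a x + tdist T y b)"
proof -
  have AB: "connected_in (edges T) A" "connected_in (edges T) B" "x \<in> A" "y \<in> B" "A \<inter> B = {}" "{x, y} \<in> edges T"
    using sp by (auto simp: edge_split_def)
  obtain p where p: "path_between T a x p" "set p \<subseteq> A" using connected_in_path[OF AB(1)] assms AB by auto
  obtain p' where p': "path_between T y b p'" "set p' \<subseteq> B" using connected_in_path[OF AB(2)] assms AB by auto
  have "path_between T a b (p @ p')" using p p' AB by (intro path_between_append) auto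
  moreover have "p \<noteq> []" "p' \<noteq> []" using p p' by (auto simp: path_between_def walk_def)
  ultimately show ?thesis
    using tdist_eq[OF T] p p' by (cases p; cases p') force+
qed

section \<open>Rooted bounds and the distance from the core to the center\<close>

lemma num_connected_singleton [simp]: "num_connected E {x} x = 1"
proof -
  have "{U. U \<subseteq> {x} \<and> x \<in> U \<and> connected_in E U} = {{x}}" by auto
  thus ?thesis by (simp add: num_connected_def)
qed

lemma card_split: "edge_split E x y A B \<Longrightarrow> finite A \<Longrightarrow> finite B \<Longrightarrow> card (A \<union> B) = card A + card B"
  by (simp add: edge_split_def card_Un_disjoint)

lemma deg_in_split_right:
  assumes "edge_split E x y A B" "finite A" "finite B"
  shows "deg_in E (A \<union> B) y = Suc (deg_in E B y)"
    and "z \<in> B \<Longrightarrow> z \<noteq> y \<Longrightarrow> deg_in E (A \<union> B) z = deg_in E B z"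
  using deg_in_split[OF edge_split_sym[OF assms(1)] assms(3,2)] by (auto simp: Un_commute)

context
  fixes E :: "'a set set" and V S :: "'a set" and r :: 'a
  assumes br: "bridges E V" and S: "S \<subseteq> V" "finite S" "connected_in E S" "r \<in> S"
begin

text \<open>Each vertex contributes its path to the root; inductively, \<open>a * (1 + b)\<close> is
  at least \<open>a + b\<close> once \<open>a\<close> is positive.\<close>

lemma num_connected_ge_card: "card S \<le> num_connected E S r"
  using br S
proof (induction rule: connected_in_root_induct)
  case (join A B x y)
  have "card A * 1 \<le> num_connected E A x * 1" "card B \<le> num_connected E B y" using join by auto
  moreover have "1 \<le> card A" using join by (auto simp: edge_split_def Suc_le_eq card_gt_0_iff)
  ultimately have "card A + card B \<le> num_connected E A x + num_connected E A x * num_connected E B y"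
    using mult_le_mono[of 1 "num_connected E A x" "card B" "num_connected E B y"] by simp
  thus ?case using join by (simp add: num_connected_split card_split)
qed simp

lemma num_connected_le_pow: "num_connected E S r \<le> 2 ^ (card S - 1)"
proof -
  have "num_connected E S r \<le> card (insert r ` Pow (S - {r}))"
    unfolding num_connected_def
  proof (rule card_mono)
    show "{U. U \<subseteq> S \<and> r \<in> U \<and> connected_in E U} \<subseteq> insert r ` Pow (S - {r})"
    proof
      fix U assume "U \<in> {U. U \<subseteq> S \<and> r \<in> U \<and> connected_in E U}"
      hence "U = insert r (U - {r})" "U - {r} \<in> Pow (S - {r})" by auto
      thus "U \<in> insert r ` Pow (S - {r})" by (rule image_eqI)
    qed
  qed (use S in simp)
  also have "\<dots> \<le> card (Pow (S - {r}))" using S by (intro card_image_le) simp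
  finally show ?thesis using S by (simp add: card_Pow)
qed

text \<open>The path from \<open>r\<close> to \<open>w\<close> may be extended by any set of further
  neighbours of \<open>w\<close>. If \<open>w\<close> is not the root, one neighbour already lies on
  that path, which costs the factor 2.\<close>

lemma num_connected_ge_deg:
  "w \<in> S \<Longrightarrow> 2 ^ deg_in E S w \<le> (if w = r then 1 else 2) * num_connected E S r"
  using br S
proof (induction arbitrary: w rule: connected_in_root_induct)
  case (single x)
  have "{x, x} \<notin> E" using br unfolding bridges_def by blast
  hence "{v \<in> {x}. {x, v} \<in> E} = {}" by auto
  thus ?case using single by (simp add: deg_in_def del: Collect_empty_eq)
next
  case (join A B x y)
  note sp = join(1) and fin = join(3,4)
  have x: "x \<in> A" "y \<in> B" "A \<inter> B = {}" "x \<noteq> y" using sp by (auto simp: edge_split_def)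
  have pos: "1 \<le> num_connected E A x" using join(5)[OF x(1)] by simp (metis One_nat_def Suc_le_eq one_le_numeral one_le_power order_trans)
  have Bpos: "1 \<le> num_connected E B y" using join(6)[OF x(2)] by simp (metis One_nat_def Suc_le_eq one_le_numeral one_le_power order_trans)
  have N: "num_connected E (A \<union> B) x = num_connected E A x * Suc (num_connected E B y)"
    using sp fin by (rule num_connected_split)
  have NA: "2 * num_connected E A x \<le> num_connected E (A \<union> B) x"
    unfolding N using Bpos by (simp add: algebra_simps)
  have NB: "num_connected E B y \<le> num_connected E (A \<union> B) x"
    unfolding N mult_Suc_right using mult_le_mono1[OF pos, of "num_connected E B y"] by linarith
  consider "w = x" | "w \<in> A" "w \<noteq> x" | "w = y" | "w \<in> B" "w \<noteq> y" using join(7) by blast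
  thus ?case
  proof cases
    case 1
    thus ?thesis using join(5)[OF x(1)] deg_in_split(1)[OF sp fin] NA by simp
  next
    case 2
    thus ?thesis using join(5)[of w] deg_in_split(2)[OF sp fin] NA by simp
  next
    case 3
    thus ?thesis using join(6)[OF x(2)] deg_in_split_right(1)[OF sp fin] NB x by simp
  next
    case 4
    thus ?thesis using join(6)[of w] deg_in_split_right(2)[OF sp fin] NB x by auto
  qed
qed

lemma deg_in_less_card:
  assumes "w \<in> S"
  shows "deg_in E S w < card S"
proof -
  have "{w, w} \<notin> E" using br unfolding bridges_def by blast
  hence "{v \<in> S. {w, v} \<in> E} \<subseteq> S - {w}" by auto
  hence "deg_in E S w \<le> card (S - {w})" unfolding deg_in_def using S by (intro card_mono) auto
  also have "\<dots> < card S" using S assms by (intro psubset_card_mono) auto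
  finally show ?thesis .
qed

text \<open>The root has at most \<open>q\<close> branches, and the edge towards the root leaves at
  most \<open>q\<close> branches at any other vertex. Replacing each branch by a heap of the same
  order can only help, and so can replacing the whole afterwards.\<close>

lemma num_connected_le_heap_count:
  assumes q: "2 \<le> q" and deg: "deg_in E S r \<le> q" "\<And>w. w \<in> S \<Longrightarrow> w \<noteq> r \<Longrightarrow> deg_in E S w \<le> Suc q"
  shows "num_connected E S r \<le> heap_count q (card S)"
proof -
  let ?p = "\<lambda>x. \<Prod>i<q. Suc (heap_count q (x i))"
  \<comment> \<open>The slots from the degree of the root on are kept empty, so that the next branch
    has slot \<open>d\<close> to go to.\<close>
  have "deg_in E S r \<le> q \<Longrightarrow> (\<forall>w\<in>S. w \<noteq> r \<longrightarrow> deg_in E S w \<le> Suc q) \<Longrightarrow>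
    \<exists>x. Suc (\<Sum>i<q. x i) = card S \<and> (\<forall>i\<ge>deg_in E S r. x i = 0) \<and> num_connected E S r \<le> ?p x"
    using br S
  proof (induction rule: connected_in_root_induct)
    case (single x)
    show ?case using heap_count_0[OF q] by (intro exI[of _ "\<lambda>_. 0"]) simp
  next
    case (join A B x y)
    note sp = join(1) and fin = join(3,4) and bound = join(8)
    have x: "x \<in> A" "y \<in> B" "A \<inter> B = {}" "x \<noteq> y" using sp by (auto simp: edge_split_def)
    define d where "d = deg_in E A x"
    have d: "deg_in E (A \<union> B) x = Suc d" "d < q"
      using deg_in_split(1)[OF sp fin] join(7) by (auto simp: d_def)
    have "deg_in E A w \<le> Suc q" if "w \<in> A" "w \<noteq> x" for w
      using deg_in_split(2)[OF sp fin that] bound that by force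
    then obtain xa where xa: "Suc (\<Sum>i<q. xa i) = card A" "\<And>i. d \<le> i \<Longrightarrow> xa i = 0"
      "num_connected E A x \<le> ?p xa"
      using join(5) d unfolding d_def by auto
    have "deg_in E B y \<le> q" using deg_in_split_right(1)[OF sp fin] bound x by force
    moreover have "deg_in E B w \<le> Suc q" if "w \<in> B" "w \<noteq> y" for w
      using deg_in_split_right(2)[OF sp fin that] bound that x by force
    ultimately obtain xb where xb: "Suc (\<Sum>i<q. xb i) = card B" "num_connected E B y \<le> ?p xb"
      using join(6) by auto
    have NB: "num_connected E B y \<le> heap_count q (card B)"
      using xb heap_count_ge_prod[OF q, of xb] by simp
    let ?x = "xa(d := card B)" let ?R = "{..<q} - {d}"
    have dq: "d \<in> {..<q}" using d by simp
    have "(\<Sum>i<q. xa i) = (\<Sum>i\<in>?R. xa i)"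
      using sum.remove[OF finite_lessThan dq, of xa] xa(2)[of d] by simp
    hence 1: "Suc (\<Sum>i<q. ?x i) = card (A \<union> B)"
      using xa(1) by (subst sum_fun_upd[OF finite_lessThan dq]) (simp add: card_split[OF sp fin])
    have "?p xa = (\<Prod>i\<in>?R. Suc (heap_count q (xa i)))"
      using prod.remove[OF finite_lessThan dq, of "\<lambda>i. Suc (heap_count q (xa i))"] xa(2)[of d] heap_count_0[OF q] by simp
    moreover have "?p ?x = Suc (heap_count q (card B)) * (\<Prod>i\<in>?R. Suc (heap_count q (xa i)))"
      by (rule prod_fun_upd[OF finite_lessThan dq, where f = "\<lambda>i. Suc (heap_count q i)"])
    ultimately have "?p ?x = ?p xa * Suc (heap_count q (card B))" by simp
    moreover have "num_connected E (A \<union> B) x \<le> ?p xa * Suc (heap_count q (card B))"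
      unfolding num_connected_split[OF sp fin] using xa(3) NB by (intro mult_le_mono) auto
    ultimately show ?case using 1 d xa(2) by (intro exI[of _ ?x]) auto
  qed
  then obtain x where "Suc (\<Sum>i<q. x i) = card S" "num_connected E S r \<le> ?p x" using deg by blast
  thus ?thesis using heap_count_ge_prod[OF q, of x] by simp
qed

end

lemma tdist_self: "is_tree T \<Longrightarrow> v \<in> verts T \<Longrightarrow> tdist T v v = 0"
  using tdist_eq[of T v v "[v]"] by (simp add: path_between_def walk_iff)

text \<open>The degree of the root stays explicit because the induction attaches its branches one by
  one; each has height less than \<open>h\<close> and hence at most \<open>perfect_size q h\<close>
  vertices.\<close>

lemma card_le_height:
  assumes T: "is_tree T" and S: "S \<subseteq> verts T" "connected_in (edges T) S" "r \<in> S"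
    and deg: "\<And>w. w \<in> S \<Longrightarrow> w \<noteq> r \<Longrightarrow> deg_in (edges T) S w \<le> Suc q"
    and h: "\<And>z. z \<in> S \<Longrightarrow> tdist T r z \<le> h"
  shows "card S \<le> Suc (deg_in (edges T) S r * perfect_size q h)"
proof -
  let ?E = "edges T"
  have "finite S" using T S finite_subset by (auto simp: is_tree_def simple_graph_def)
  have "(\<forall>w\<in>S. w \<noteq> r \<longrightarrow> deg_in ?E S w \<le> Suc q) \<Longrightarrow> (\<forall>z\<in>S. tdist T r z \<le> h) \<Longrightarrow>
    card S \<le> Suc (deg_in ?E S r * perfect_size q h)"
    using tree_bridges[OF T] S(1) \<open>finite S\<close> S(2,3)
  proof (induction arbitrary: h rule: connected_in_root_induct)
    case (join A B x y)
    note sp = join(1) and fin = join(3,4) and deg = join(7) and h = join(8)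
    have x: "x \<in> A" "y \<in> B" "A \<inter> B = {}" "x \<noteq> y" using sp by (auto simp: edge_split_def)
    have V: "A \<union> B \<subseteq> verts T" using join(2) S(1) by blast
    have dA: "deg_in ?E A w \<le> Suc q" if "w \<in> A" "w \<noteq> x" for w
      using deg_in_split(2)[OF sp fin that] deg that by force
    hence cA: "card A \<le> Suc (deg_in ?E A x * perfect_size q h)" using join(5) h by auto
    have degy: "deg_in ?E B y \<le> q" using deg_in_split_right(1)[OF sp fin] deg x by force
    have dB: "deg_in ?E B w \<le> Suc q" if "w \<in> B" "w \<noteq> y" for w
      using deg_in_split_right(2)[OF sp fin that] deg that x by force
    have dist: "Suc (tdist T y z) \<le> h" if "z \<in> B" for z
      using tdist_split[OF T sp V x(1) that] tdist_self[OF T subsetD[OF V UnI1[OF x(1)]]]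
        bspec[OF h UnI2[OF that]] by simp
    then obtain h' where h': "h = Suc h'" using x(2) by (cases h) auto
    have "card B \<le> Suc (deg_in ?E B y * perfect_size q h')" using join(6)[of h'] dB dist h' by auto
    also have "\<dots> \<le> Suc (q * perfect_size q h')" using degy by simp
    also have "\<dots> = perfect_size q h" using h' perfect_size_Suc' by simp
    finally show ?case using cA deg_in_split(1)[OF sp fin] card_split[OF sp fin] by simp
  qed simp
  thus ?thesis using deg h by blast
qed

lemma exists_deep_vertex:
  assumes T: "is_tree T" and S: "S \<subseteq> verts T" "connected_in (edges T) S" "r \<in> S"
    and deg: "deg_in (edges T) S r \<le> q" "\<And>w. w \<in> S \<Longrightarrow> w \<noteq> r \<Longrightarrow> deg_in (edges T) S w \<le> Suc q"
    and h: "perfect_size q h < card S"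
  shows "\<exists>z\<in>S. h \<le> tdist T r z"
proof (rule ccontr)
  assume *: "\<not> ?thesis"
  then obtain h' where h': "h = Suc h'" using S by (cases h) auto
  have "card S \<le> Suc (deg_in (edges T) S r * perfect_size q h')"
    using * h' by (intro card_le_height[OF T S deg(2)]) (auto simp: not_le)
  also have "\<dots> \<le> Suc (q * perfect_size q h')" using deg by simp
  also have "\<dots> = perfect_size q h" using h' perfect_size_Suc' by simp
  finally show False using h by simp
qed

lemma tree_facts:
  assumes "is_tree T"
  shows "finite (verts T)" "verts T \<noteq> {}" "connected_in (edges T) (verts T)" "simple_graph T"
  using assms by (auto simp: is_tree_def simple_graph_def connected_graph_iff)

lemma tdist_le_ecc: "is_tree T \<Longrightarrow> u \<in> verts T \<Longrightarrow> tdist T v u \<le> ecc T v"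
  unfolding ecc_def using tree_facts(1) by (intro Max_ge) auto

lemma ecc_attained:
  assumes "is_tree T"
  obtains u where "u \<in> verts T" "tdist T v u = ecc T v"
proof -
  have "ecc T v \<in> (\<lambda>u. tdist T v u) ` verts T"
    unfolding ecc_def using tree_facts[OF assms] by (intro Max_in) auto
  thus ?thesis using that by auto
qed

lemma center_nonempty: "is_tree T \<Longrightarrow> center T \<noteq> {}"
  using ex_min_if_finite[of "ecc T ` verts T"] tree_facts[of T]
  unfolding center_def by (force simp: not_less)

lemma subtree_core_nonempty:
  assumes "is_tree T"
  shows "subtree_core T \<noteq> {}"
proof -
  let ?f = "num_subtrees_at T"
  have "Max (?f ` verts T) \<in> ?f ` verts T" using tree_facts[OF assms] by (intro Max_in) auto
  then obtain v where v: "v \<in> verts T" "?f v = Max (?f ` verts T)" by auto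
  have "?f u \<le> ?f v" if "u \<in> verts T" for u using v(2) that tree_facts[OF assms] by simp
  thus ?thesis using v by (auto simp: subtree_core_def)
qed

lemma set_dist_props:
  assumes "is_tree T"
  obtains u c where "u \<in> subtree_core T" "c \<in> center T"
    "tdist T u c = set_dist T (subtree_core T) (center T)"
    "\<And>u' c'. u' \<in> subtree_core T \<Longrightarrow> c' \<in> center T \<Longrightarrow> tdist T u c \<le> tdist T u' c'"
proof -
  let ?D = "{tdist T u v | u v. u \<in> subtree_core T \<and> v \<in> center T}"
  have sub: "subtree_core T \<subseteq> verts T" "center T \<subseteq> verts T"
    by (auto simp: subtree_core_def center_def)
  have eq: "?D = (\<lambda>(u, v). tdist T u v) ` (subtree_core T \<times> center T)" by auto
  have fin: "finite ?D" unfolding eq using sub tree_facts(1)[OF assms]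
    by (intro finite_imageI finite_cartesian_product) (auto intro: finite_subset)
  have "?D \<noteq> {}" using center_nonempty subtree_core_nonempty assms by blast
  hence "Min ?D \<in> ?D" using fin by (rule Min_in[rotated])
  then obtain u c where uc: "u \<in> subtree_core T" "c \<in> center T" "tdist T u c = Min ?D" by auto
  have "tdist T u c \<le> tdist T u' c'" if "u' \<in> subtree_core T" "c' \<in> center T" for u' c'
    unfolding uc(3) using fin that by (intro Min_le) auto
  thus ?thesis using that uc by (simp add: set_dist_def)
qed

text \<open>The number \<open>m\<close> is the order of the side \<open>A\<close> containing the
  core vertex. The first and third properties are the conditions that \<open>n_prime\<close>
  minimizes, which keeps \<open>n_prime\<close> itself out of the geometric argument.\<close>

lemma core_center_bound:
  assumes T: "is_tree T" and q: "2 \<le> q" and maxdeg: "max_degree T = Suc q"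
    and D: "D = set_dist T (subtree_core T) (center T)" "0 < D"
  obtains m where "Suc q \<le> m" "m \<le> order T" "order T \<le> heap_count q m + m"
    "\<And>h. perfect_size q h < m \<Longrightarrow> m + 2 * D + h \<le> order T"
proof -
  let ?E = "edges T" and ?V = "verts T"
  note V = tree_facts[OF T]
  have br: "bridges ?E ?V" by (rule tree_bridges[OF T])
  have deg_le: "deg_in ?E ?V w \<le> Suc q" if "w \<in> ?V" for w
  proof -
    have "degree T w \<le> max_degree T" unfolding max_degree_def using V that by (intro Max_ge) auto
    thus ?thesis using degree_conv[OF V(4) that] maxdeg by simp
  qed
  have "max_degree T \<in> degree T ` ?V" unfolding max_degree_def using V by (intro Max_in) auto
  then obtain w0 where w0: "w0 \<in> ?V" "deg_in ?E ?V w0 = Suc q"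
    using degree_conv[OF V(4)] maxdeg by force
  obtain u c where uc: "u \<in> subtree_core T" "c \<in> center T" "tdist T u c = D"
    and min: "\<And>u' c'. u' \<in> subtree_core T \<Longrightarrow> c' \<in> center T \<Longrightarrow> D \<le> tdist T u' c'"
    using set_dist_props[OF T] D(1) by metis
  have uV: "u \<in> ?V" and cV: "c \<in> ?V" using uc by (auto simp: subtree_core_def center_def)
  have next_vertex: "\<exists>y. y \<in> ?V \<and> {x, y} \<in> ?E \<and> Suc (tdist T y z) = tdist T x z"
    if xz: "x \<in> ?V" "z \<in> ?V" "0 < tdist T x z" for x z
  proof -
    obtain p where p: "path_between T x z p" using connected_in_path[OF V(3) order_refl xz(1,2)] by blast
    have len: "tdist T x z = length p - 1" using tdist_eq[OF T p] .
    obtain y ps where py: "p = x # y # ps"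
      using p len xz(3) by (cases p rule: remdups_adj.cases) (auto simp: path_between_def)
    have "path_between T y z (y # ps)" using p unfolding py path_between_def walk_iff by auto
    from tdist_eq[OF T this] show ?thesis
      using p len unfolding py path_between_def walk_iff by auto
  qed
  obtain v where v: "v \<in> ?V" "{u, v} \<in> ?E" "Suc (tdist T v c) = D"
    using next_vertex[OF uV cV] uc(3) D(2) by auto
  obtain c' where c': "c' \<in> ?V" "{c', c} \<in> ?E" "Suc (tdist T u c') = D"
    using next_vertex[OF cV uV] uc(3) D(2) tdist_commute[OF T] uV cV by (metis insert_commute)
  obtain A B where AB: "edge_split ?E u v A B" "A \<union> B = ?V"
    using edge_split_exists[OF br V(3) order_refl uV v(1,2)] by blast
  \<comment> \<open>A second cut, at the last edge before \<open>c\<close>, serves the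
    eccentricities; the first cut serves the subtree counts. For \<open>D = 1\<close> both are the
    same edge.\<close>
  obtain A' B' where AB': "edge_split ?E c' c A' B'" "A' \<union> B' = ?V"
    using edge_split_exists[OF br V(3) order_refl c'(1) cV c'(2)] by blast
  note BA = edge_split_sym[OF AB(1)]
  have mem: "u \<in> A" "v \<in> B" "c' \<in> A'" "c \<in> B'" "A \<inter> B = {}" "connected_in ?E A" "connected_in ?E B"
    using AB AB' by (auto simp: edge_split_def)
  have fin: "finite A" "finite B" using AB(2) V(1) by (metis finite_Un)+
  have sub: "A \<subseteq> ?V" "B \<subseteq> ?V" "A \<union> B \<subseteq> ?V" "B \<union> A \<subseteq> ?V" "A' \<union> B' \<subseteq> ?V" using AB(2) AB'(2) by auto
  note self = tdist_self[OF T]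
  note comm = tdist_commute[OF T]
  have cB: "c \<in> B"
  proof (rule ccontr)
    assume "c \<notin> B"
    hence "c \<in> A" using cV AB(2) by auto
    from tdist_split[OF T AB(1) sub(3) this mem(2)] show False
      using self[OF v(1)] comm[OF uV cV] comm[OF v(1) cV] uc(3) v(3) by simp
  qed
  have uA': "u \<in> A'"
  proof (rule ccontr)
    assume "u \<notin> A'"
    hence "u \<in> B'" using uV AB'(2) by auto
    from tdist_split[OF T AB'(1) sub(5) mem(3) this] show False
      using self[OF c'(1)] comm[OF uV cV] comm[OF uV c'(1)] uc(3) c'(3) by simp
  qed
  have "v \<notin> subtree_core T" using min[OF _ uc(2), of v] v(3) by auto
  hence lt: "num_subtrees_at T v < num_subtrees_at T u"
    using v(1) uc(1) unfolding subtree_core_def by (force simp: not_le)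
  let ?NA = "num_connected ?E A u" and ?NB = "num_connected ?E B v"
  \<comment> \<open>By the product formula the counts at \<open>u\<close> and \<open>v\<close>
    differ exactly by \<open>?NA - ?NB\<close>.\<close>
  have NBA: "?NB < ?NA"
    using lt num_connected_split[OF AB(1) fin] num_connected_split[OF BA fin(2,1)] AB(2)
    by (simp add: num_subtrees_at_conv uV v(1) Un_commute algebra_simps)
  have NB: "card B \<le> ?NB" using num_connected_ge_card[OF br sub(2) fin(2) mem(7,2)] .
  have degA: "deg_in ?E A u \<le> q" "\<And>w. w \<in> A \<Longrightarrow> w \<noteq> u \<Longrightarrow> deg_in ?E A w \<le> Suc q"
    using deg_in_split[OF AB(1) fin] deg_le AB(2) uV by force+
  have NA: "?NA \<le> heap_count q (card A)"
    by (rule num_connected_le_heap_count[OF br sub(1) fin(1) mem(6,1) q degA])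
  have card: "card A + card B = order T" using card_split[OF AB(1) fin] AB(2) by simp
  have large: "Suc q \<le> card A"
  proof (rule ccontr)
    assume small: "\<not> Suc q \<le> card A"
    have "w0 \<in> B"
    proof (rule ccontr)
      assume "w0 \<notin> B"
      hence "w0 \<in> A" using w0 AB(2) by auto
      hence "q \<le> deg_in ?E A w0"
        using w0(2) deg_in_split[OF AB(1) fin] AB(2) by (cases "w0 = u") auto
      thus False using deg_in_less_card[OF br sub(1) fin(1) mem(6,1) \<open>w0 \<in> A\<close>] small by simp
    qed
    have "2 ^ Suc q \<le> 2 * ?NB"
      using num_connected_ge_deg[OF br sub(2) fin(2) mem(7,2) \<open>w0 \<in> B\<close>] w0(2) AB(2)
        deg_in_split_right[OF AB(1) fin] \<open>w0 \<in> B\<close> by (cases "w0 = v") auto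
    moreover have "?NA \<le> 2 ^ (card A - 1)"
      by (rule num_connected_le_pow[OF br sub(1) fin(1) mem(6,1)])
    moreover have "(2::nat) ^ (card A - 1) \<le> 2 ^ q" using small by (intro power_increasing) auto
    ultimately show False using NBA by simp
  qed
  \<comment> \<open>Stepping back to \<open>c'\<close> strictly raises the eccentricity, so a vertex
    farthest from \<open>c'\<close> must lie on the side of \<open>c\<close>.\<close>
  have "c' \<notin> center T" using min[OF uc(1), of c'] c'(3) by auto
  hence ecc: "ecc T c < ecc T c'"
    using c'(1) uc(2) unfolding center_def by (force simp: not_le)
  obtain w where w: "w \<in> ?V" "tdist T c' w = ecc T c'" using ecc_attained[OF T] .
  have wB': "w \<in> B'"
  proof (rule ccontr)
    assume "w \<notin> B'"
    hence "w \<in> A'" using w AB'(2) by auto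
    from tdist_split[OF T AB'(1) sub(5) this mem(4)] show False
      using self[OF cV] comm[OF w(1) cV] comm[OF w(1) c'(1)] w(2) ecc tdist_le_ecc[OF T w(1), of c] by simp
  qed
  have cw: "ecc T c \<le> tdist T c w"
    using tdist_split[OF T AB'(1) sub(5) mem(3) wB'] self[OF c'(1)] w(2) ecc by simp
  have uw: "tdist T u w = D + tdist T c w"
    using tdist_split[OF T AB'(1) sub(5) uA' wB'] c'(3) by simp
  have wB: "w \<in> B"
  proof (rule ccontr)
    assume "w \<notin> B"
    hence "w \<in> A" using w AB(2) by auto
    from tdist_split[OF T BA sub(4) cB this] show False
      using uw D(2) by simp
  qed
  have "tdist T u w = Suc (tdist T v w)"
    using tdist_split[OF T AB(1) sub(3) mem(1) wB] self[OF uV] by simp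
  \<comment> \<open>The distance from \<open>v\<close> to \<open>w\<close> is at least
    \<open>D - 1\<close> plus the eccentricity of \<open>c\<close>, and its path stays inside
    \<open>B\<close>; counting vertices instead of edges adds 1.\<close>
  hence cardB: "D + ecc T c \<le> card B"
    using uw cw tdist_less_card[OF T mem(7) sub(2) mem(2) wB] by simp
  show ?thesis
  proof (rule that[of "card A"])
    show "Suc q \<le> card A" by (rule large)
    show "card A \<le> order T" "order T \<le> heap_count q (card A) + card A"
      using card NA NB NBA by auto
    fix h assume "perfect_size q h < card A"
    then obtain z where z: "z \<in> A" "h \<le> tdist T u z"
      using exists_deep_vertex[OF T sub(1) mem(6,1) degA] by blast
    have "D + h \<le> tdist T c z"
      using tdist_split[OF T BA sub(4) cB z(1)] z(2) v(3) comm[OF cV v(1)] by simp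
    also have "\<dots> \<le> ecc T c" using z(1) sub by (intro tdist_le_ecc[OF T]) auto
    finally show "card A + 2 * D + h \<le> order T" using cardB card by simp
  qed
qed

section \<open>Trees given by parent functions\<close>

definition parent_tree :: "(nat \<Rightarrow> nat) \<Rightarrow> nat \<Rightarrow> nat graph" where
  "parent_tree p n = Graph {..<n} {{p j, j} | j. 0 < j \<and> j < n}"

lemma verts_parent_tree [simp]: "verts (parent_tree p n) = {..<n}"
  by (simp add: parent_tree_def)

text \<open>The condition \<open>v < d\<close> makes the recursion terminate for every
  \<open>p\<close>, so the function can be defined outside the locale.\<close>

function rooted_count :: "(nat \<Rightarrow> nat) \<Rightarrow> nat \<Rightarrow> nat \<Rightarrow> nat" where
  "rooted_count p n v = (\<Prod>d\<in>{d. v < d \<and> d < n \<and> p d = v}. Suc (rooted_count p n d))"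
  by auto
termination by (relation "measure (\<lambda>(p, n, v). n - v)") auto

declare rooted_count.simps [simp del]

locale parent_function =
  fixes p :: "nat \<Rightarrow> nat" and n :: nat
  assumes pos: "0 < n" and p_less: "0 < j \<Longrightarrow> j < n \<Longrightarrow> p j < j"
begin

abbreviation "E \<equiv> edges (parent_tree p n)"

lemma edge_iff: "{a, b} \<in> E \<longleftrightarrow> 0 < b \<and> b < n \<and> a = p b \<or> 0 < a \<and> a < n \<and> b = p a"
  by (auto simp: parent_tree_def doubleton_eq_iff)

lemma edge_less_iff: "a < b \<Longrightarrow> {a, b} \<in> E \<longleftrightarrow> b < n \<and> a = p b"
  using p_less[of a] p_less[of b] by (auto simp: edge_iff)

lemma parent_edge: "0 < j \<Longrightarrow> j < n \<Longrightarrow> {p j, j} \<in> E"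
  by (simp add: edge_iff)

lemma closed_connected_in:
  assumes U: "U \<subseteq> {..<n}" "\<And>j. j \<in> U \<Longrightarrow> r < j \<Longrightarrow> p j \<in> U" "\<And>j. j \<in> U \<Longrightarrow> r \<le> j"
  shows "connected_in E U"
proof (rule connected_in_rootI)
  fix z assume "z \<in> U"
  thus "(r, z) \<in> (adj E U)\<^sup>*"
  proof (induction z rule: less_induct)
    case (less z)
    show ?case
    proof (cases "z = r")
      case False
      hence z: "r < z" "z < n" using U less.prems by force+
      have "(p z, z) \<in> adj E U"
        using less.prems U z parent_edge[of z] by (auto simp: adj_def)
      moreover have "(r, p z) \<in> (adj E U)\<^sup>*"
        using less.prems z U p_less[of z] by (intro less.IH) auto
      ultimately show ?thesis by (rule rtrancl_into_rtrancl[rotated])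
    qed simp
  qed
qed

lemma connected_in_lessThan: "j \<le> n \<Longrightarrow> connected_in E {..<j}"
proof (rule closed_connected_in[of _ 0])
  fix i assume "j \<le> n" "i \<in> {..<j}" "0 < i"
  thus "p i \<in> {..<j}" using p_less[of i] by auto
qed auto

text \<open>If the parent of \<open>j\<close> is missing, a walk inside \<open>U\<close> starting at
  \<open>j\<close> can never get above \<open>j\<close>; it meets only descendants of
  \<open>j\<close> and so misses 0.\<close>

lemma connected_in_closed:
  assumes U: "U \<subseteq> {..<n}" "connected_in E U" "0 \<in> U" "j \<in> U" "0 < j"
  shows "p j \<in> U"
proof (rule ccontr)
  assume pj: "p j \<notin> U"
  define R where "R = {(p x, x) | x. 0 < x \<and> x < n}"
  have "(j, x) \<in> R\<^sup>*" if "(j, x) \<in> (adj E U)\<^sup>*" for x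
    using that
  proof induction
    case (step w w')
    have w: "w \<in> U" "w' \<in> U" "{w, w'} \<in> E" using step(2) by (auto simp: adj_def)
    show ?case
    proof (cases "0 < w' \<and> w' < n \<and> w = p w'")
      case True
      hence "(w, w') \<in> R" by (auto simp: R_def)
      thus ?thesis using step(3) by (rule rtrancl_into_rtrancl[rotated])
    next
      case False
      hence w': "w' = p w" "0 < w" using w by (auto simp: edge_iff)
      hence "w \<noteq> j" using pj w by auto
      then obtain x where "(j, x) \<in> R\<^sup>*" "(x, w) \<in> R" using step(3) by (metis rtranclE)
      thus ?thesis using w' by (auto simp: R_def)
    qed
  qed simp
  hence "(j, 0) \<in> R\<^sup>*" using U by (auto simp: connected_in_def)
  moreover have "(x, 0) \<notin> R" for x by (auto simp: R_def)
  ultimately show False using U(5) by (metis rtranclE less_irrefl)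
qed

text \<open>Both neighbours of the largest vertex of a cycle are smaller, so both would be its
  parent.\<close>

lemma tree: "is_tree (parent_tree p n)"
  unfolding is_tree_def
proof (intro conjI notI)
  show "simple_graph (parent_tree p n)"
    unfolding simple_graph_def
  proof (intro conjI ballI)
    fix e assume "e \<in> E"
    then obtain j where "e = {p j, j}" "0 < j" "j < n" by (auto simp: parent_tree_def)
    thus "\<exists>u v. u \<in> verts (parent_tree p n) \<and> v \<in> verts (parent_tree p n) \<and> u \<noteq> v \<and> e = {u, v}"
      using p_less[of j] by (intro exI[of _ "p j"] exI[of _ j]) auto
  qed simp
  show "connected_graph (parent_tree p n)"
    using connected_in_lessThan[of n] pos by (auto simp: connected_graph_iff)
  assume "\<exists>c. cycle (parent_tree p n) c"
  then obtain c where c: "3 \<le> length c" "distinct c" "walk (parent_tree p n) (c @ [hd c])"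
    by (auto simp: cycle_def)
  define l where "l = length c"
  have c0: "hd c = c ! 0" using c(1) by (intro hd_conv_nth) auto
  have step: "{c ! i, c ! Suc i} \<in> E" if "Suc i < l" for i
    using c(3) that unfolding walk_def l_def by (auto simp: nth_append dest!: spec[of _ i])
  have last: "{c ! (l - 1), c ! 0} \<in> E"
    
  proof -
    have "l - 1 < l" "Suc (l - 1) = l" using c(1) by (auto simp: l_def)
    thus ?thesis using c(3) c0 unfolding walk_def l_def
      by (auto simp: nth_append dest!: spec[of _ "length c - 1"])
  qed
  define M where "M = Max (set c)"
  have "M \<in> set c" using c(1) unfolding M_def by (intro Max_in) auto
  then obtain i where i: "i < l" "c ! i = M" by (auto simp: in_set_conv_nth l_def)
  have nb: "c ! j = p M" if "j < l" "j \<noteq> i" "{c ! j, M} \<in> E" for j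
  proof -
    have "c ! j \<le> M" using that(1) unfolding M_def l_def by simp
    moreover have "c ! j \<noteq> M" using that i c(2) by (auto simp: l_def nth_eq_iff_index_eq)
    ultimately show ?thesis using that(3) edge_less_iff[of "c ! j" M] by simp
  qed
  define a where "a = (if i = 0 then l - 1 else i - 1)"
  define b where "b = (if Suc i < l then Suc i else 0)"
  have "3 \<le> l" using c(1) by (simp add: l_def)
  hence ab: "a < l" "b < l" "a \<noteq> i" "b \<noteq> i" "a \<noteq> b" using i by (auto simp: a_def b_def)
  have "{c ! a, M} \<in> E"
    using last step[of "i - 1"] i by (auto simp: a_def insert_commute)
  moreover have "{c ! b, M} \<in> E"
  proof (cases "Suc i < l")
    case False
    hence "i = l - 1" using i by simp
    thus ?thesis using last i False by (simp add: b_def insert_commute)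
  qed (use step[of i] i in \<open>simp add: b_def insert_commute\<close>)
  ultimately have "c ! a = c ! b" using nb[OF ab(1,3)] nb[OF ab(2,4)] by metis
  thus False using ab c(2) by (simp add: l_def nth_eq_iff_index_eq)
qed

lemma deg_in_eq:
  assumes "v < n"
  shows "deg_in E {..<n} v = card {d. 0 < d \<and> d < n \<and> p d = v} + (if v = 0 then 0 else 1)"
proof -
  let ?C = "{d. 0 < d \<and> d < n \<and> p d = v}"
  have "{w \<in> {..<n}. {v, w} \<in> E} = ?C \<union> (if v = 0 then {} else {p v})"
    using assms p_less[of v] by (auto simp: edge_iff)
  moreover have "?C \<inter> {p v} = {}" if "v \<noteq> 0"
    using that assms p_less[of v] p_less[of "p v"] by force
  ultimately show ?thesis by (simp add: deg_in_def card_Un_disjoint)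
qed

text \<open>Parents being smaller, the vertices up to \<open>j\<close> form a subtree in which
  \<open>j\<close> is a leaf.\<close>

lemma tdist_step:
  assumes "a < j" "j < n"
  shows "tdist (parent_tree p n) a j = Suc (tdist (parent_tree p n) a (p j))"
proof -
  have j: "0 < j" using assms by simp
  have "edge_split E (p j) j {..<j} {j}"
    unfolding edge_split_def
    using p_less[OF j assms(2)] connected_in_lessThan[of j] parent_edge[OF j assms(2)] assms edge_less_iff
    by auto
  from tdist_split[OF tree this _ _ singletonI] show ?thesis
    using assms tdist_self[OF tree] by auto
qed

definition closed_sets :: "nat \<Rightarrow> nat set set" where
  "closed_sets j = {U. U \<subseteq> {..<j} \<and> 0 \<in> U \<and> (\<forall>d\<in>U. 0 < d \<longrightarrow> p d \<in> U)}"

lemma num_connected_closed: "num_connected E {..<n} 0 = card (closed_sets n)"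
proof -
  have "{U. U \<subseteq> {..<n} \<and> 0 \<in> U \<and> connected_in E U} = closed_sets n"
    using connected_in_closed closed_connected_in[of _ 0] unfolding closed_sets_def by blast
  thus ?thesis by (simp add: num_connected_def)
qed

text \<open>The largest vertex \<open>j\<close> is a leaf; deleting it multiplies the weight of its parent by
  \<open>Suc (w j)\<close>.\<close>

lemma closed_sets_weight_Suc:
  fixes w :: "nat \<Rightarrow> nat"
  assumes j: "0 < j" "j < n"
  shows "(\<Sum>U\<in>closed_sets (Suc j). \<Prod>v\<in>U. w v) =
    (\<Sum>U\<in>closed_sets j. \<Prod>v\<in>U. (w(p j := w (p j) * Suc (w j))) v)"
proof -
  let ?w = "w(p j := w (p j) * Suc (w j))"
  let ?C = "closed_sets j" and ?P = "{U \<in> closed_sets j. p j \<in> U}"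
  have fin: "finite (closed_sets i)" for i
    by (rule finite_subset[of _ "Pow {..<i}"]) (auto simp: closed_sets_def)
  have sub: "U \<subseteq> {..<j}" "finite U" "j \<notin> U" if "U \<in> ?C" for U
    using that finite_subset[of U "{..<j}"] by (auto simp: closed_sets_def)
  have less: "p d < d" if "0 < d" "d < Suc j" for d using p_less[of d] that j by simp
  have eq: "closed_sets (Suc j) = ?C \<union> insert j ` ?P"
  proof
    show "closed_sets (Suc j) \<subseteq> ?C \<union> insert j ` ?P"
    proof
      fix U assume U: "U \<in> closed_sets (Suc j)"
      show "U \<in> ?C \<union> insert j ` ?P"
      proof (cases "j \<in> U")
        case True
        have "p d \<noteq> j" if "d \<in> U" "0 < d" for d
          using less[of d] that U by (auto simp: closed_sets_def)
        hence "U - {j} \<in> ?P" using U True j by (auto simp: closed_sets_def less_Suc_eq)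
        moreover have "U = insert j (U - {j})" using True by auto
        ultimately show ?thesis by blast
      next
        case False
        thus ?thesis using U by (auto simp: closed_sets_def less_Suc_eq)
      qed
    qed
    show "?C \<union> insert j ` ?P \<subseteq> closed_sets (Suc j)"
      by (auto simp: closed_sets_def less_Suc_eq)
  qed
  have disj: "?C \<inter> insert j ` ?P = {}" using sub(3) by auto
  have inj: "inj_on (insert j) ?P" using sub(3) by (auto intro!: inj_onI simp: insert_ident)
  have w: "(\<Prod>v\<in>U. ?w v) = (\<Prod>v\<in>U. w v) + (if p j \<in> U then w j * (\<Prod>v\<in>U. w v) else 0)"
    if "U \<in> ?C" for U
  proof (cases "p j \<in> U")
    case True
    have "(\<Prod>v\<in>U. ?w v) = w (p j) * Suc (w j) * (\<Prod>v\<in>U - {p j}. w v)"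
      using prod_fun_upd[OF sub(2)[OF that] True, of "\<lambda>x. x" w] by simp
    moreover have "(\<Prod>v\<in>U. w v) = w (p j) * (\<Prod>v\<in>U - {p j}. w v)"
      by (rule prod.remove[OF sub(2)[OF that] True])
    ultimately show ?thesis using True by (simp add: algebra_simps)
  qed (auto intro!: prod.cong)
  have "(\<Sum>U\<in>closed_sets (Suc j). \<Prod>v\<in>U. w v) = (\<Sum>U\<in>?C. \<Prod>v\<in>U. w v) + (\<Sum>U\<in>insert j ` ?P. \<Prod>v\<in>U. w v)"
    unfolding eq using fin disj by (intro sum.union_disjoint) auto
  also have "(\<Sum>U\<in>insert j ` ?P. \<Prod>v\<in>U. w v) = (\<Sum>U\<in>?P. w j * (\<Prod>v\<in>U. w v))"
    by (subst sum.reindex[OF inj]) (auto intro!: sum.cong simp: sub)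
  also have "\<dots> = (\<Sum>U\<in>?C. if p j \<in> U then w j * (\<Prod>v\<in>U. w v) else 0)"
    using fin by (simp add: sum.inter_filter)
  finally show ?thesis using w by (simp add: sum.distrib)
qed

text \<open>Vertices are deleted from the largest down, and each deleted leaf is absorbed into the
  weight of its parent. The weighted number of closed sets stays constant until only the root is
  left.\<close>

lemma num_connected_rooted_count: "num_connected E {..<n} 0 = rooted_count p n 0"
proof -
  \<comment> \<open>The weight of \<open>v\<close> once the vertices from \<open>j\<close> on are
    gone: the product over its deleted children. It is 1 for \<open>j = n\<close>.\<close>
  define W where "W j v = (\<Prod>d\<in>{d. j \<le> d \<and> d < n \<and> p d = v}. Suc (rooted_count p n d))" for j v
  let ?Z = "\<lambda>j. \<Sum>U\<in>closed_sets j. \<Prod>v\<in>U. W j v"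
  have step: "?Z (Suc j) = ?Z j" if j: "0 < j" "j < n" for j
  proof -
    have "W (Suc j) j = rooted_count p n j"
      by (simp add: W_def rooted_count.simps[of p n j] Suc_le_eq)
    moreover have "W j (p j) = Suc (rooted_count p n j) * W (Suc j) (p j)"
    proof -
      have "{d. j \<le> d \<and> d < n \<and> p d = p j} = insert j {d. Suc j \<le> d \<and> d < n \<and> p d = p j}"
        using j by auto
      thus ?thesis by (simp add: W_def)
    qed
    moreover have "W j v = W (Suc j) v" if "v \<noteq> p j" for v
      unfolding W_def using that by (intro prod.cong) (auto simp: Suc_le_eq order_le_less)
    ultimately have "W j = (W (Suc j))(p j := W (Suc j) (p j) * Suc (W (Suc j) j))"
      by (auto simp: fun_eq_iff)
    thus ?thesis using closed_sets_weight_Suc[OF j, of "W (Suc j)"] by simp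
  qed
  have "?Z j = ?Z 1" if "1 \<le> j" "j \<le> n" for j
    using that
  proof (induction j rule: dec_induct)
    case (step i)
    show ?case using step.IH step.prems step.hyps by (subst \<open>\<And>j. 0 < j \<Longrightarrow> j < n \<Longrightarrow> ?Z (Suc j) = ?Z j\<close>) auto
  qed simp
  hence "?Z n = ?Z 1" using pos by (metis One_nat_def Suc_leI order_refl)
  moreover have "?Z n = card (closed_sets n)"
  proof -
    have "{d. n \<le> d \<and> d < n \<and> p d = v} = {}" for v by auto
    hence "W n v = 1" for v by (simp only: W_def prod.empty)
    thus ?thesis by simp
  qed
  moreover have "?Z 1 = rooted_count p n 0"
  proof -
    have "closed_sets 1 = {{0}}" by (auto simp: closed_sets_def)
    moreover have "W 1 0 = rooted_count p n 0" by (simp add: W_def rooted_count.simps[of p n 0] Suc_le_eq)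
    ultimately show ?thesis by simp
  qed
  ultimately show ?thesis by (simp only: num_connected_closed)
qed

end

section \<open>Heap-ordered trees as parent trees\<close>

definition heap_parent :: "nat \<Rightarrow> nat \<Rightarrow> nat" where
  "heap_parent q j = (j - 1) div q"

lemma heap_parent_less: "0 < j \<Longrightarrow> heap_parent q j < j"
  unfolding heap_parent_def by (metis One_nat_def Suc_pred div_le_dividend le_imp_less_Suc)

lemma heap_parent_eq_iff:
  assumes "0 < q" "0 < d"
  shows "heap_parent q d = v \<longleftrightarrow> q * v < d \<and> d \<le> q * v + q"
proof
  assume "heap_parent q d = v"
  hence "d - 1 = q * v + (d - 1) mod q" by (auto simp: heap_parent_def)
  thus "q * v < d \<and> d \<le> q * v + q" using mod_less_divisor[OF assms(1), of "d - 1"] assms(2) by linarith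
next
  assume "q * v < d \<and> d \<le> q * v + q"
  thus "heap_parent q d = v" unfolding heap_parent_def using assms by (intro div_nat_eqI) auto
qed

text \<open>Vertex \<open>i\<close> of level \<open>l\<close> has \<open>g\<close> complete levels
  in its subtree and receives its own block of \<open>q ^ g\<close> positions on the last level, of
  which the first \<open>t\<close> overall are occupied.\<close>

lemma rooted_count_heap:
  assumes q: "2 \<le> q" and n: "n = perfect_size q h + t" "t \<le> q ^ h"
  shows "l + g = h \<Longrightarrow> i < q ^ l \<Longrightarrow> perfect_size q l + i < n \<Longrightarrow>
    rooted_count (heap_parent q) n (perfect_size q l + i) = level_count q g (min (q ^ g) (t - i * q ^ g))"
proof (induction g arbitrary: l i)
  case 0
  have "{d. perfect_size q l + i < d \<and> d < n \<and> heap_parent q d = perfect_size q l + i} = {}"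
  proof -
    have False if "d < n" "q * (perfect_size q h + i) < d" for d
    proof -
      have "perfect_size q (Suc h) \<le> d" using that(2) unfolding perfect_size_Suc' by (simp add: algebra_simps)
      thus False using that(1) n by (simp add: perfect_size_Suc)
    qed
    thus ?thesis using 0 q heap_parent_eq_iff[of q] by auto
  qed
  thus ?case using 0 n by (subst rooted_count.simps) (simp only: prod.empty, simp)
next
  case (Suc g)
  let ?v = "perfect_size q l + i" and ?Q = "q ^ g"
  let ?d = "\<lambda>j. perfect_size q (Suc l) + (q * i + j)"
  have d: "?d j = Suc (q * ?v + j)" for j by (simp add: perfect_size_Suc' algebra_simps)
  have idx: "q * i + j < q ^ Suc l" if "j < q" for j
  proof -
    have "q * Suc i \<le> q * q ^ l" using Suc.prems(2) by (intro mult_le_mono2) simp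
    thus ?thesis using that by simp
  qed
  have ch: "{d. ?v < d \<and> d < n \<and> heap_parent q d = ?v} = ?d ` {j. j < q \<and> ?d j < n}"
  proof
    show "{d. ?v < d \<and> d < n \<and> heap_parent q d = ?v} \<subseteq> ?d ` {j. j < q \<and> ?d j < n}"
    proof
      fix x assume x: "x \<in> {d. ?v < d \<and> d < n \<and> heap_parent q d = ?v}"
      hence "q * ?v < x" "x \<le> q * ?v + q" using heap_parent_eq_iff[of q x ?v] q by auto
      hence "x = ?d (x - Suc (q * ?v))" "x - Suc (q * ?v) < q" unfolding d by auto
      thus "x \<in> ?d ` {j. j < q \<and> ?d j < n}" using x by (intro image_eqI[of x ?d "x - Suc (q * ?v)"]) auto
    qed
    show "?d ` {j. j < q \<and> ?d j < n} \<subseteq> {d. ?v < d \<and> d < n \<and> heap_parent q d = ?v}"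
    proof (rule image_subsetI)
      fix j assume j: "j \<in> {j. j < q \<and> ?d j < n}"
      have "?v \<le> q * ?v" using q by simp
      hence "?v < ?d j" unfolding d by linarith
      moreover have "heap_parent q (?d j) = ?v"
        using j q heap_parent_eq_iff[of q "?d j" ?v] unfolding d by simp
      ultimately show "?d j \<in> {d. ?v < d \<and> d < n \<and> heap_parent q d = ?v}" using j by simp
    qed
  qed
  have inj: "inj_on ?d {j. j < q \<and> ?d j < n}" by (simp add: inj_on_def)
  \<comment> \<open>A child can be absent only on the last level, \<open>g = 0\<close>; there
    \<open>level_count q 0 0 = 0\<close> makes its factor 1, as for an omitted index.\<close>
  have val: "(if ?d j < n then Suc (rooted_count (heap_parent q) n (?d j)) else 1)
      = Suc (level_count q g (min ?Q (t - (q * i + j) * ?Q)))" if j: "j < q" for j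
  proof (cases "?d j < n")
    case True
    thus ?thesis using Suc.IH[of "Suc l" "q * i + j"] Suc.prems(1) idx[OF j] by simp
  next
    case False
    have "g = 0"
    proof (rule ccontr)
      assume "g \<noteq> 0"
      hence "perfect_size q (Suc (Suc l)) \<le> perfect_size q h" using Suc.prems(1) by (intro perfect_size_mono[OF q]) simp
      thus False using False idx[OF j] n by (simp add: perfect_size_Suc)
    qed
    thus ?thesis using False n Suc.prems(1) by simp
  qed
  have min: "min ?Q (t - (q * i + j) * ?Q) = min ?Q (min (q ^ Suc g) (t - i * q ^ Suc g) - j * ?Q)"
    if j: "j < q" for j
  proof -
    have "Suc j * ?Q \<le> q * ?Q" using j by (intro mult_le_mono1) simp
    hence 1: "?Q \<le> q * ?Q - j * ?Q" by simp
    have "(q * i + j) * ?Q = i * (q * ?Q) + j * ?Q" by (simp add: algebra_simps)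
    hence 2: "t - (q * i + j) * ?Q = (t - i * (q * ?Q)) - j * ?Q" by simp
    show ?thesis unfolding 2 power_Suc using 1 by (auto simp: min_def)
  qed
  have "rooted_count (heap_parent q) n ?v = (\<Prod>j\<in>{j. j < q \<and> ?d j < n}. Suc (rooted_count (heap_parent q) n (?d j)))"
    by (subst rooted_count.simps, subst ch, subst prod.reindex[OF inj]) simp
  also have "\<dots> = (\<Prod>j\<in>{j \<in> {..<q}. ?d j < n}. Suc (rooted_count (heap_parent q) n (?d j)))"
    by (intro prod.cong) auto
  also have "\<dots> = (\<Prod>j<q. if ?d j < n then Suc (rooted_count (heap_parent q) n (?d j)) else 1)"
    by (rule prod.inter_filter) simp
  also have "\<dots> = (\<Prod>j<q. Suc (level_count q g (min ?Q (min (q ^ Suc g) (t - i * q ^ Suc g) - j * ?Q))))"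
    using val min by (intro prod.cong) auto
  also have "\<dots> = level_count q (Suc g) (min (q ^ Suc g) (t - i * q ^ Suc g))" by simp
  finally show ?case .
qed

lemma num_connected_heap:
  assumes "2 \<le> q" "0 < n"
  shows "num_connected (edges (parent_tree (heap_parent q) n)) {..<n} 0 = heap_count q n"
proof -
  obtain h where h: "perfect_size q h < n" "n \<le> perfect_size q (Suc h)" using perfect_size_bracket[OF assms] .
  define t where "t = n - perfect_size q h"
  have t: "n = perfect_size q h + t" "t \<le> q ^ h" using h by (auto simp: t_def perfect_size_Suc)
  interpret parent_function "heap_parent q" n using assms heap_parent_less by unfold_locales auto
  have "rooted_count (heap_parent q) n 0 = level_count q h t"
    using rooted_count_heap[OF assms(1) t, of 0 h 0] t(2) assms by simp
  thus ?thesis using num_connected_rooted_count heap_count_perfect_size_add[OF assms(1) t(2)] t(1) by simp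
qed

section \<open>Extended rgood trees and the tight example\<close>

text \<open>The root and the next \<open>a\<close> vertices have \<open>q\<close> children each,
  vertex \<open>Suc a\<close> has \<open>s - 1\<close>, the others none. So the prefix sums of the
  child numbers are multiples of \<open>q\<close> cut off at \<open>m - 1\<close>, and the blocks of
  children are those of a heap.\<close>

lemma rgood_children:
  assumes q: "2 \<le> q" and s: "1 \<le> s" "s \<le> q" and m: "m = Suc a * q + s" "m = a + 2 + b"
    and ds: "ds = replicate a (Suc q) @ [q, s] @ replicate b 1" and i: "i < m"
  shows "j \<in> children ds q i \<longleftrightarrow> 0 < j \<and> j < m \<and> heap_parent q j = i"
proof -
  let ?c = "num_children ds q"
  have "remove1 q ds = replicate a (Suc q) @ [s] @ replicate b 1"
    unfolding ds by (simp add: remove1_append)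
  hence c: "?c i = (if i \<le> a then q else if i = Suc a then s - 1 else 0)" if "i < m" for i
    using that m(2) unfolding num_children_def
    by (auto simp: nth_append nth_Cons' split: if_splits)
  have c': "?c i = min (Suc i * q) (m - 1) - min (i * q) (m - 1)" if "i < m" for i
  proof -
    consider "i \<le> a" | "i = Suc a" | "Suc a < i" by linarith
    thus ?thesis
    proof cases
      case 1
      hence "Suc i * q \<le> Suc a * q" by (intro mult_le_mono1) simp
      moreover have "i * q \<le> Suc i * q" by simp
      ultimately have "Suc i * q \<le> m - 1" "i * q \<le> m - 1" using m(1) s by linarith+
      thus ?thesis using c[OF that] 1 by simp
    next
      case 2
      thus ?thesis using c[OF that] m(1) s by simp
    next
      case 3
      hence "Suc (Suc a) * q \<le> i * q" by (intro mult_le_mono1) simp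
      hence "m - 1 \<le> i * q" using m(1) s by simp
      thus ?thesis using c[OF that] 3 by simp
    qed
  qed
  have sum: "(\<Sum>j<i. ?c j) = min (i * q) (m - 1)" if "i \<le> m" for i
    using that
  proof (induction i)
    case (Suc i)
    have "i * q \<le> Suc i * q" by simp
    hence "min (i * q) (m - 1) \<le> min (Suc i * q) (m - 1)" by (rule min.mono) simp
    thus ?case using Suc c'[of i] by simp
  qed simp
  have sums: "(\<Sum>j<i. ?c j) = min (q * i) (m - 1)" "(\<Sum>j<Suc i. ?c j) = min (q * i + q) (m - 1)"
    using sum[of i] sum[of "Suc i"] i by (simp_all add: mult.commute add.commute del: sum.lessThan_Suc)
  have "j \<in> children ds q i \<longleftrightarrow> Suc (min (q * i) (m - 1)) \<le> j \<and> j < Suc (min (q * i + q) (m - 1))"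
    by (simp only: children_def sums atLeastLessThan_iff plus_1_eq_Suc)
  also have "\<dots> \<longleftrightarrow> 0 < j \<and> j < m \<and> (q * i < j \<and> j \<le> q * i + q)"
    using i by linarith
  also have "\<dots> \<longleftrightarrow> 0 < j \<and> j < m \<and> heap_parent q j = i"
    using heap_parent_eq_iff[of q j i] q by auto
  finally show ?thesis .
qed

lemma rgood_tree_eq:
  assumes "2 \<le> q" "1 \<le> s" "s \<le> q" "m = Suc a * q + s" "m = a + 2 + b"
    and ds: "ds = replicate a (Suc q) @ [q, s] @ replicate b 1"
  shows "rooted_greedy_tree ds q = parent_tree (heap_parent q) m"
proof -
  have len: "length ds = m" using assms(5) ds by simp
  note ch = rgood_children[OF assms]
  have less: "heap_parent q j < m" if "0 < j" "j < m" for j using heap_parent_less[OF that(1), of q] that by simp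
  have "{{i, j} | i j. i < m \<and> j \<in> children ds q i} = {{heap_parent q j, j} | j. 0 < j \<and> j < m}"
    (is "?A = ?B")
  proof (intro equalityI subsetI)
    fix e assume "e \<in> ?A"
    then obtain i j where "e = {i, j}" "i < m" "j \<in> children ds q i" by blast
    thus "e \<in> ?B" using ch[of i j] by auto
  next
    fix e assume "e \<in> ?B"
    then obtain j where j: "e = {heap_parent q j, j}" "0 < j" "j < m" by blast
    hence "j \<in> children ds q (heap_parent q j)" using ch[OF less] by simp
    thus "e \<in> ?A" using j less by blast
  qed
  thus ?thesis unfolding rooted_greedy_tree_def parent_tree_def len by simp
qed

lemma extended_rgood_iff:
  assumes q: "2 \<le> q"
  shows "extended_rgood (Suc q) m T \<longleftrightarrow> Suc q \<le> m \<and> T = parent_tree (heap_parent q) m"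
proof
  assume "extended_rgood (Suc q) m T"
  then obtain a s b ds where s: "1 \<le> s" "s \<le> q"
    and ds: "ds = replicate a (Suc q) @ [q, s] @ replicate b 1"
    and len: "length ds = m" "sum_list ds = 2 * (m - 1)" and T: "T = rooted_greedy_tree ds q"
    unfolding extended_rgood_def by auto
  have mb: "m = a + 2 + b" using len(1) ds by simp
  have "a * Suc q + q + s + b = 2 * (m - 1)" using len(2) ds by (simp add: sum_list_replicate)
  hence m: "m = Suc a * q + s" using mb by simp
  show "Suc q \<le> m \<and> T = parent_tree (heap_parent q) m"
    using rgood_tree_eq[OF q s m mb ds] T m s by simp
next
  assume *: "Suc q \<le> m \<and> T = parent_tree (heap_parent q) m"
  \<comment> \<open>Every vertex but the root is a child, so
    \<open>m - 1 = Suc a * q + (s - 1)\<close>; division with remainder determines \<open>a\<close>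
    and \<open>s\<close>.\<close>
  define a where "a = (m - 1) div q - 1"
  define s where "s = Suc ((m - 1) mod q)"
  define b where "b = m - (a + 2)"
  define ds where "ds = replicate a (Suc q) @ [q, s] @ replicate b 1"
  have s: "1 \<le> s" "s \<le> q" using q mod_less_divisor[of q "m - 1"] by (auto simp: s_def Suc_le_eq)
  have "q \<le> m - 1" using * by linarith
  hence "1 \<le> (m - 1) div q" using q by (simp add: Suc_le_eq div_greater_zero_iff)
  hence "Suc a = (m - 1) div q" by (simp add: a_def)
  hence m: "m = Suc a * q + s" using div_mult_mod_eq[of "m - 1" q] * by (simp add: s_def)
  have "Suc a * 2 \<le> Suc a * q" using q by (rule mult_le_mono2)
  hence mb: "m = a + 2 + b" using m s by (simp add: b_def)
  have len: "length ds = m" using mb by (simp add: ds_def)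
  have "sum_list ds = 2 * (m - 1)"
    using m mb s by (simp add: ds_def sum_list_replicate)
  thus "extended_rgood (Suc q) m T"
    unfolding extended_rgood_def using s ds_def len rgood_tree_eq[OF q s m mb ds_def] *
    by (intro exI[of _ a] exI[of _ s] exI[of _ b] exI[of _ ds]) auto
qed

section \<open>The constants \<open>n_prime\<close> and \<open>h_prime\<close>\<close>

lemma num_subtrees_heap:
  assumes "2 \<le> q" "0 < m"
  shows "num_subtrees_at (parent_tree (heap_parent q) m) 0 = heap_count q m"
  using num_subtrees_at_conv[of 0 "parent_tree (heap_parent q) m"] num_connected_heap[OF assms] assms by simp

lemma n_prime_eq:
  assumes "2 \<le> q"
  shows "n_prime n (Suc q) = (LEAST m. Suc q \<le> m \<and> n \<le> heap_count q m + m)"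
proof -
  have "(\<exists>T. extended_rgood (Suc q) m T \<and> int (num_subtrees_at T 0) \<ge> int n - int (order T)) \<longleftrightarrow>
      Suc q \<le> m \<and> n \<le> heap_count q m + m" for m
    using num_subtrees_heap[OF assms, of m] by (auto simp: extended_rgood_iff[OF assms])
  thus ?thesis by (simp add: n_prime_def)
qed

lemma n_prime_props:
  assumes "2 \<le> q"
  shows "Suc q \<le> n_prime n (Suc q)" "n \<le> heap_count q (n_prime n (Suc q)) + n_prime n (Suc q)"
    and "Suc q \<le> m \<Longrightarrow> n \<le> heap_count q m + m \<Longrightarrow> n_prime n (Suc q) \<le> m"
proof -
  let ?P = "\<lambda>m. Suc q \<le> m \<and> n \<le> heap_count q m + m"
  have "?P (max (Suc q) n)" by auto
  hence "?P (LEAST m. ?P m)" by (rule LeastI)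
  thus "Suc q \<le> n_prime n (Suc q)" "n \<le> heap_count q (n_prime n (Suc q)) + n_prime n (Suc q)"
    unfolding n_prime_eq[OF assms] by auto
  show "Suc q \<le> m \<Longrightarrow> n \<le> heap_count q m + m \<Longrightarrow> n_prime n (Suc q) \<le> m"
    unfolding n_prime_eq[OF assms] by (rule Least_le) simp
qed

lemma perfect_size_geometric: "0 < q \<Longrightarrow> perfect_size q h * (q - 1) + 1 = q ^ h"
proof (induction h)
  case (Suc h)
  have "perfect_size q (Suc h) * (q - 1) + 1 = q * (perfect_size q h * (q - 1) + 1)"
    using Suc.prems by (cases q) (simp_all add: perfect_size_Suc' algebra_simps)
  thus ?case using Suc by (simp only: power_Suc)
qed simp

text \<open>\<open>h_prime\<close> is the height of the heap on \<open>n_prime\<close> vertices: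
  multiplied by \<open>q - 1\<close> and increased by 1, the perfect sizes become powers of
  \<open>q\<close>, and the rounded logarithm finds the window.\<close>

lemma h_prime_eq:
  assumes q: "2 \<le> q" and h: "perfect_size q h < n_prime n (Suc q)" "n_prime n (Suc q) \<le> perfect_size q (Suc h)"
  shows "h_prime n (Suc q) = int h"
proof -
  define X where "X = n_prime n (Suc q) * (q - 1) + 1"
  have pow: "perfect_size q h' * (q - 1) + 1 = q ^ h'" for h' using perfect_size_geometric q by simp
  have X: "q ^ h < X" "X \<le> q ^ Suc h"
    unfolding pow[symmetric] X_def using h q by (auto intro: mult_less_mono1 mult_le_mono1)
  have "real X = real (n_prime n (Suc q)) * (real (Suc q) - 2) + 1"
    using q by (simp add: X_def of_nat_diff)
  moreover have "\<lceil>ln (real X) / ln (real q)\<rceil> = int h + 1"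
  proof (rule ceiling_unique)
    have lnq: "0 < ln (real q)" using q by simp
    have "ln (real q ^ h) < ln (real X)"
      using X(1) q by (subst ln_less_cancel_iff) (simp_all flip: of_nat_power)
    hence "real h * ln (real q) < ln (real X)" using q by (simp add: ln_realpow)
    thus "of_int (int h + 1) - 1 < ln (real X) / ln (real q)" using lnq by (simp add: pos_less_divide_eq)
    have "0 < X" by (simp add: X_def)
    hence "ln (real X) \<le> ln (real q ^ Suc h)"
      using X(2) q by (subst ln_le_cancel_iff) (simp_all del: power_Suc flip: of_nat_power)
    also have "\<dots> = real (Suc h) * ln (real q)" by (rule ln_realpow)
    finally show "ln (real X) / ln (real q) \<le> of_int (int h + 1)"
      using lnq by (simp add: pos_divide_le_eq algebra_simps)
  qed
  ultimately show ?thesis by (simp add: h_prime_def)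
qed

lemma dist_bound_eq:
  "dist_bound n k = int n - int (n_prime n k) - (int n - int (n_prime n k) + h_prime n k) div 2"
proof -
  have "1 / 2 * (real n - real (n_prime n k) + real_of_int (h_prime n k)) =
      real_of_int (int n - int (n_prime n k) + h_prime n k) / real_of_int 2" by simp
  thus ?thesis unfolding dist_bound_def by (simp only: floor_divide_of_int_eq)
qed

text \<open>This covers \<open>D = 0\<close> in the upper bound and provides a nonempty path for the
  example. If \<open>n_prime\<close> exceeds \<open>k\<close>, the next smaller order fails its
  condition, so \<open>n\<close> exceeds \<open>2 * (n_prime - 1)\<close>; otherwise the height is
  at most 1.\<close>

lemma path_length:
  assumes q: "2 \<le> q" and n: "Suc q < n" and h: "perfect_size q h < n_prime n (Suc q)" "n_prime n (Suc q) \<le> perfect_size q (Suc h)"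
  shows "n_prime n (Suc q) + h \<le> n" "n_prime n (Suc q) < n"
proof -
  let ?m = "n_prime n (Suc q)"
  have "?m + h \<le> n \<and> ?m < n"
  proof (cases "?m = Suc q")
    case True
    have "h \<le> 1"
    proof (rule ccontr)
      assume "\<not> h \<le> 1"
      hence "perfect_size q (Suc 1) \<le> perfect_size q h" by (intro perfect_size_mono[OF q]) simp
      thus False using h(1) True by (simp add: perfect_size_Suc)
    qed
    thus ?thesis using True n by simp
  next
    case False
    hence m: "Suc q \<le> ?m - 1" using n_prime_props(1)[OF q, of n] by simp
    hence "heap_count q (?m - 1) + (?m - 1) < n"
      using n_prime_props(3)[OF q, of "?m - 1" n] by (cases "heap_count q (?m - 1) + (?m - 1) < n") auto
    moreover have "?m - 1 \<le> heap_count q (?m - 1)" by (rule heap_count_ge[OF q])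
    moreover have "h \<le> ?m - 1" using perfect_size_ge[OF q, of h] h(1) by simp
    ultimately show ?thesis using m by linarith
  qed
  thus "?m + h \<le> n" "?m < n" by auto
qed

lemma max_degree_less_order:
  assumes T: "is_tree T"
  shows "max_degree T < order T"
proof -
  note V = tree_facts[OF T]
  have "max_degree T \<in> degree T ` verts T" unfolding max_degree_def using V by (intro Max_in) auto
  then obtain w where w: "w \<in> verts T" "max_degree T = degree T w" by auto
  show ?thesis
    unfolding w(2) degree_conv[OF V(4) w(1)]
    by (rule deg_in_less_card[OF tree_bridges[OF T] order_refl V(1) V(3) w(1) w(1)])
qed

lemma set_dist_le_dist_bound:
  assumes T: "is_tree T" "max_degree T = Suc q" and q: "2 \<le> q"
  shows "int (set_dist T (subtree_core T) (center T)) \<le> dist_bound (order T) (Suc q)"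
proof -
  let ?n = "order T" let ?m = "n_prime ?n (Suc q)"
  define D where "D = set_dist T (subtree_core T) (center T)"
  have "0 < ?m" using n_prime_props(1)[OF q, of ?n] by simp
  then obtain h where h: "perfect_size q h < ?m" "?m \<le> perfect_size q (Suc h)" using perfect_size_bracket[OF q] by blast
  have n: "Suc q < ?n" using max_degree_less_order[OF T(1)] T(2) by simp
  \<comment> \<open>This is slightly stronger than the goal, since \<open>dist_bound\<close> rounds
    half of \<open>?n - ?m - h\<close> upwards.\<close>
  have "?m + 2 * D + h \<le> ?n"
  proof (cases "D = 0")
    case True
    thus ?thesis using path_length[OF q n h] by simp
  next
    case False
    then obtain m where m: "Suc q \<le> m" "?n \<le> heap_count q m + m"
      "\<And>h. perfect_size q h < m \<Longrightarrow> m + 2 * D + h \<le> ?n"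
      using core_center_bound[OF T(1) q T(2) D_def] by blast
    have "?m \<le> m" using m by (intro n_prime_props(3)[OF q])
    thus ?thesis using m(3)[of h] h(1) by simp
  qed
  thus ?thesis unfolding dist_bound_eq h_prime_eq[OF q h] D_def[symmetric] by simp
qed

section \<open>The heap with a path attached at its root\<close>

definition tail_parent :: "nat \<Rightarrow> nat \<Rightarrow> nat \<Rightarrow> nat" where
  "tail_parent q m j = (if j < m then heap_parent q j else if j = m then 0 else j - 1)"

lemma tail_parent_simps [simp]:
  "j < m \<Longrightarrow> tail_parent q m j = heap_parent q j" "tail_parent q m m = 0"
  "m < j \<Longrightarrow> tail_parent q m j = j - 1"
  by (simp_all add: tail_parent_def)

lemma rgood_with_path_eq:
  assumes "n_prime n k = m" "0 < m" "m \<le> n"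
  shows "rgood_with_path n k (parent_tree (heap_parent q) m) = parent_tree (tail_parent q m) n"
proof -
  let ?xs = "0 # [m..<n]"
  have "{{?xs ! i, ?xs ! Suc i} | i. Suc i < length ?xs} = {{tail_parent q m j, j} | j. m \<le> j \<and> j < n}"
    (is "?A = ?B")
  proof
    have eq: "{?xs ! i, ?xs ! Suc i} = {tail_parent q m (m + i), m + i}" if "i < n - m" for i
      using that by (cases i) (auto simp: tail_parent_def)
    show "?A \<subseteq> ?B" using eq by fastforce
    show "?B \<subseteq> ?A"
    proof
      fix e assume "e \<in> ?B"
      then obtain j where j: "e = {tail_parent q m j, j}" "m \<le> j" "j < n" by auto
      hence "e = {?xs ! (j - m), ?xs ! Suc (j - m)}" using eq[of "j - m"] by simp
      moreover have "Suc (j - m) < length ?xs" using j by simp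
      ultimately show "e \<in> ?A" by blast
    qed
  qed
  moreover have "{{heap_parent q j, j} | j. 0 < j \<and> j < m} = {{tail_parent q m j, j} | j. 0 < j \<and> j < m}"
    by (auto simp: tail_parent_def)
  moreover have "{{tail_parent q m j, j} | j. 0 < j \<and> j < m} \<union> {{tail_parent q m j, j} | j. m \<le> j \<and> j < n}
      = {{tail_parent q m j, j} | j. 0 < j \<and> j < n}"
    using assms(2,3) by force
  moreover have "{..<m} \<union> set ?xs = {..<n}" using assms(2,3) by auto
  ultimately show ?thesis
    unfolding rgood_with_path_def attach_path_def assms(1) by (simp add: parent_tree_def)
qed

locale heap_with_tail =
  fixes q m n :: nat
  assumes q: "2 \<le> q" and m: "Suc q \<le> m" and n: "m < n"
begin

abbreviation "T \<equiv> parent_tree (tail_parent q m) n"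

sublocale parent_function "tail_parent q m" n
proof
  show "tail_parent q m j < j" if "0 < j" "j < n" for j
    using that heap_parent_less[OF that(1), of q] by (simp add: tail_parent_def)
qed (use n in simp)

lemma deg_root: "deg_in E {..<n} 0 = Suc q"
proof -
  have "{d. 0 < d \<and> d < n \<and> tail_parent q m d = 0} = insert m {1..q}"
    using m n q heap_parent_eq_iff[of q _ 0] unfolding tail_parent_def by auto
  thus ?thesis using deg_in_eq[of 0] n m by simp
qed

lemma deg_le: "v < n \<Longrightarrow> deg_in E {..<n} v \<le> Suc q"
proof -
  assume v: "v < n"
  have "card {d. 0 < d \<and> d < n \<and> tail_parent q m d = v} \<le> q" if "v \<noteq> 0"
  proof (cases "v < m")
    case True
    have "{d. 0 < d \<and> d < n \<and> tail_parent q m d = v} \<subseteq> {q * v + 1..q * v + q}"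
    proof
      fix d assume d: "d \<in> {d. 0 < d \<and> d < n \<and> tail_parent q m d = v}"
      hence "d < m" using that True by (cases d m rule: linorder_cases) auto
      thus "d \<in> {q * v + 1..q * v + q}" using d q heap_parent_eq_iff[of q d v] by auto
    qed
    from card_mono[OF _ this] show ?thesis by simp
  next
    case False
    have "{d. 0 < d \<and> d < n \<and> tail_parent q m d = v} \<subseteq> {Suc v}"
    proof
      fix d assume d: "d \<in> {d. 0 < d \<and> d < n \<and> tail_parent q m d = v}"
      show "d \<in> {Suc v}"
        using d False that heap_parent_less[of d q] by (auto simp: tail_parent_def split: if_splits)
    qed
    from card_mono[OF _ this] show ?thesis using q by simp
  qed
  thus ?thesis using deg_root deg_in_eq[OF v] by (cases "v = 0") auto
qed

lemma max_degree_T: "max_degree T = Suc q"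
proof -
  have deg: "degree T v = deg_in E {..<n} v" if "v < n" for v
    using degree_conv[of T v] tree_facts(4)[OF tree] that by simp
  show ?thesis unfolding max_degree_def
  proof (rule Max_eqI)
    show "y \<le> Suc q" if "y \<in> degree T ` verts T" for y
      using that deg deg_le by auto
    have "Suc q = degree T 0" using deg[of 0] deg_root n by simp
    thus "Suc q \<in> degree T ` verts T" using n by (intro image_eqI[of _ _ 0]) auto
  qed simp
qed

lemma connected_in_tail: "m \<le> v \<Longrightarrow> v < n \<Longrightarrow> connected_in E {v..<n}"
  by (rule closed_connected_in[of _ v]) (auto simp: tail_parent_def)

lemma tail_split:
  assumes "m \<le> v" "v < n"
  shows "edge_split E (tail_parent q m v) v {..<v} {v..<n}"
proof -
  have "a = tail_parent q m v \<and> b = v" if "a < v" "v \<le> b" "b < n" "{a, b} \<in> E" for a b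
    using that edge_less_iff[of a b] assms(1) by (auto simp: tail_parent_def split: if_splits)
  moreover have "0 < v" using assms m by simp
  ultimately show ?thesis
    unfolding edge_split_def using p_less[of v] parent_edge[of v] connected_in_tail[OF assms] connected_in_lessThan[of v] assms
    by auto
qed

lemma num_connected_tail: "m \<le> v \<Longrightarrow> v < n \<Longrightarrow> num_connected E {v..<n} v = n - v"
proof (induction "n - v" arbitrary: v)
  case (Suc d)
  show ?case
  proof (cases "Suc v < n")
    case False
    hence "{v..<n} = {v}" using Suc.prems by auto
    thus ?thesis using False Suc.prems by simp
  next
    case True
    have sp: "edge_split E v (Suc v) {..<Suc v} {Suc v..<n}"
      using tail_split[of "Suc v"] True Suc.prems by (simp add: tail_parent_def)
    hence "edge_split E v (Suc v) {v} {Suc v..<n}" by (auto simp: edge_split_def)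
    hence "num_connected E ({v} \<union> {Suc v..<n}) v = num_connected E {v} v * Suc (num_connected E {Suc v..<n} (Suc v))"
      by (rule num_connected_split) auto
    moreover have "{v} \<union> {Suc v..<n} = {v..<n}" using Suc.prems by auto
    ultimately show ?thesis using Suc.hyps(1)[of "Suc v"] Suc.hyps(2) Suc.prems True by simp
  qed
qed simp

text \<open>The heap gives equality at \<open>v = m\<close>; every path vertex appended as the new
  root adds 1.\<close>

lemma num_connected_initial: "m \<le> v \<Longrightarrow> v < n \<Longrightarrow> heap_count q m \<le> num_connected E {..<v} (tail_parent q m v)"
proof (induction v rule: dec_induct)
  case base
  have "adj E U = adj (edges (parent_tree (heap_parent q) m)) U" if "U \<subseteq> {..<m}" for U
  proof -
    have "{x, y} \<in> E \<longleftrightarrow> {x, y} \<in> edges (parent_tree (heap_parent q) m)" if "x < m" "y < m" for x y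
      using that n by (auto simp: parent_tree_def tail_parent_def doubleton_eq_iff)
    thus ?thesis using that by (auto simp: adj_def)
  qed
  hence "num_connected E {..<m} 0 = num_connected (edges (parent_tree (heap_parent q) m)) {..<m} 0"
    unfolding num_connected_def connected_in_def by (metis (no_types, lifting))
  thus ?case using num_connected_heap[OF q, of m] m by simp
next
  case (step v)
  have v: "v < n" using step by simp
  have "edge_split E v (tail_parent q m v) {v..<n} {..<v}"
    using edge_split_sym[OF tail_split[OF step(1) v]] .
  hence "edge_split E v (tail_parent q m v) {v} {..<v}"
    using v by (auto simp: edge_split_def)
  hence "num_connected E ({v} \<union> {..<v}) v = num_connected E {v} v * Suc (num_connected E {..<v} (tail_parent q m v))"
    by (rule num_connected_split) auto
  moreover have "{v} \<union> {..<v} = {..<Suc v}" by auto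
  ultimately show ?case using step by simp
qed

text \<open>Cut above a path vertex \<open>v\<close>: below the cut there are at most
  \<open>n - m\<close> subtrees at \<open>v\<close>, above it at least \<open>heap_count q m\<close>
  at the other end. So the other end has strictly more subtrees in the whole tree.\<close>

lemma subtree_core_T:
  assumes "n - m < heap_count q m"
  shows "subtree_core T \<subseteq> {..<m}"
proof
  fix v assume v: "v \<in> subtree_core T"
  show "v \<in> {..<m}"
  proof (rule ccontr)
    assume "v \<notin> {..<m}"
    hence mv: "m \<le> v" "v < n" using v by (auto simp: subtree_core_def)
    let ?u = "tail_parent q m v"
    have u: "?u < n" using p_less[of v] mv m by simp
    note sp = tail_split[OF mv]
    have V: "{..<v} \<union> {v..<n} = {..<n}" using mv by auto
    let ?NA = "num_connected E {..<v} ?u" and ?NB = "num_connected E {v..<n} v"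
    have "?NB < ?NA" using num_connected_tail[OF mv] num_connected_initial[OF mv] assms mv by simp
    hence "num_subtrees_at T v < num_subtrees_at T ?u"
      using num_connected_split[OF sp] num_connected_split[OF edge_split_sym[OF sp]] u mv
      by (simp add: num_subtrees_at_conv V Un_commute[of "{v..<n}"] algebra_simps)
    thus False using v u by (auto simp: subtree_core_def not_less[symmetric])
  qed
qed

lemma tdist_tail: "a < m \<Longrightarrow> m + i < n \<Longrightarrow> tdist T a (m + i) = Suc (i + tdist T a 0)"
proof (induction i)
  case 0
  thus ?case using tdist_step[of a m] by simp
next
  case (Suc i)
  thus ?case using tdist_step[of a "m + Suc i"] by simp
qed

lemma tdist_tail_tail: "m + i + j < n \<Longrightarrow> tdist T (m + i) (m + i + j) = j"
proof (induction j)
  case 0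
  thus ?case using tdist_self[OF tree, of "m + i"] by simp
next
  case (Suc j)
  thus ?case using tdist_step[of "m + i" "m + i + Suc j"] by simp
qed

lemma tdist_heap_le: "z < m \<Longrightarrow> z < perfect_size q (Suc h) \<Longrightarrow> tdist T 0 z \<le> h"
proof (induction h arbitrary: z)
  case 0
  thus ?case using tdist_self[OF tree, of 0] n by (simp add: perfect_size_Suc)
next
  case (Suc h)
  show ?case
  proof (cases "z = 0")
    case True
    thus ?thesis using tdist_self[OF tree, of 0] n by simp
  next
    case False
    have "z - 1 < q * perfect_size q (Suc h)" using Suc.prems(2) False perfect_size_Suc'[of q "Suc h"] by simp
    hence "heap_parent q z < perfect_size q (Suc h)" unfolding heap_parent_def by (simp add: less_mult_imp_div_less mult.commute)
    moreover have "heap_parent q z < m" using heap_parent_less[of z q] False Suc.prems by simp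
    ultimately show ?thesis
      using Suc.IH[of "heap_parent q z"] tdist_step[of 0 z] False Suc.prems n by simp
  qed
qed

lemma tdist_heap_first: "perfect_size q h < m \<Longrightarrow> tdist T 0 (perfect_size q h) = h"
proof (induction h)
  case 0
  thus ?case using tdist_self[OF tree, of 0] n by simp
next
  case (Suc h)
  have less: "perfect_size q h < perfect_size q (Suc h)" using q by (intro perfect_size_strict_mono) auto
  have "heap_parent q (perfect_size q (Suc h)) = perfect_size q h" using q by (simp add: heap_parent_def perfect_size_Suc')
  thus ?case using Suc less tdist_step[of 0 "perfect_size q (Suc h)"] n by simp
qed

text \<open>The longest path runs from the deepest level of the heap to the end of the tail and has
  \<open>2 * (i + h)\<close> edges. Its midpoint, at distance \<open>i\<close> from the root, is the
  only center, while the core stays inside the heap.\<close>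

lemma set_dist_T_ge:
  assumes h: "perfect_size q h < m" "m \<le> perfect_size q (Suc h)" and i: "n = m + 2 * i + h" "0 < i"
    and F: "n - m < heap_count q m"
  shows "i \<le> set_dist T (subtree_core T) (center T)"
proof -
  note comm = tdist_commute[OF tree]
  let ?c = "m + (i - 1)" let ?last = "m + (2 * i + h - 1)"
  have c: "?c < n" "?last < n" "0 < m" using i m by auto
  have heap_c: "tdist T z ?c = i + tdist T z 0" if "z < m" for z
    using tdist_tail[OF that c(1)] i(2) by simp
  have depth: "tdist T z 0 \<le> h" if "z < m" for z
    using tdist_heap_le[OF that, of h] h(2) that comm[of z 0] n by simp
  have ecc_c: "ecc T ?c \<le> i + h"
  proof -
    have "tdist T ?c z \<le> i + h" if z: "z < n" for z
    proof (cases "z < m")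
      case True
      thus ?thesis using heap_c[OF True] depth[OF True] comm[of ?c z] c z by simp
    next
      case False
      define j where "j = z - m"
      have zj: "z = m + j" using False by (simp add: j_def)
      show ?thesis
      proof (cases "i - 1 \<le> j")
        case True
        thus ?thesis using tdist_tail_tail[of "i - 1" "j - (i - 1)"] zj z i by simp
      next
        case False
        thus ?thesis using tdist_tail_tail[of j "i - 1 - j"] comm[of ?c z] zj z c by simp
      qed
    qed
    moreover obtain u where "u \<in> verts T" "tdist T ?c u = ecc T ?c" using ecc_attained[OF tree] .
    ultimately show ?thesis by (metis lessThan_iff verts_parent_tree)
  qed
  \<comment> \<open>From heap vertices and tail vertices before \<open>?c\<close> the end of the
    tail is too far; from those after \<open>?c\<close> it is \<open>perfect_size q h\<close>, the
    first vertex on level \<open>h\<close>.\<close>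
  have ecc_other: "i + h < ecc T w" if w: "w < n" "w \<noteq> ?c" for w
  proof -
    have "\<exists>z<n. i + h < tdist T w z"
    proof (cases "w < m")
      case True
      have "tdist T w ?last = Suc (2 * i + h - 1 + tdist T w 0)" using tdist_tail[OF True c(2)] .
      thus ?thesis using c(2) i(2) by (intro exI[of _ ?last]) simp
    next
      case False
      define j where "j = w - m"
      have wj: "w = m + j" using False by (simp add: j_def)
      show ?thesis
      proof (cases "j < i - 1")
        case True
        hence "?last = m + j + (2 * i + h - 1 - j)" by simp
        hence "tdist T w ?last = 2 * i + h - 1 - j"
          using tdist_tail_tail[of j "2 * i + h - 1 - j"] c(2) wj by (simp add: add.assoc)
        thus ?thesis using c(2) True by (intro exI[of _ ?last]) simp
      next
        case False
        hence "i \<le> j" using w(2) wj by auto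
        have "perfect_size q h < n" using h n by simp
        moreover have "tdist T w (perfect_size q h) = Suc (j + h)"
          using tdist_tail[OF h(1), of j] comm[of w "perfect_size q h"] comm[of "perfect_size q h" 0]
            tdist_heap_first[OF h(1)] w wj h n by simp
        ultimately show ?thesis using \<open>i \<le> j\<close> by (intro exI[of _ "perfect_size q h"]) simp
      qed
    qed
    then obtain z where "z < n" "i + h < tdist T w z" by blast
    thus ?thesis using tdist_le_ecc[OF tree, of z w] by simp
  qed
  have center: "v = ?c" if v: "v \<in> center T" for v
  proof (rule ccontr)
    assume "v \<noteq> ?c"
    hence "i + h < ecc T v" using ecc_other v by (simp add: center_def)
    moreover have "ecc T v \<le> ecc T ?c" using v c(1) by (simp add: center_def)
    ultimately show False using ecc_c by simp
  qed
  obtain u v where "u \<in> subtree_core T" "v \<in> center T"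
    "tdist T u v = set_dist T (subtree_core T) (center T)"
    using set_dist_props[OF tree] .
  thus ?thesis using subtree_core_T[OF F] center heap_c by (metis le_add1 lessThan_iff subsetD)
qed

end

lemma rgood_with_path_props:
  assumes q: "2 \<le> q" and n: "Suc q < n"
  defines "m \<equiv> n_prime n (Suc q)"
  defines "T \<equiv> rgood_with_path n (Suc q) (parent_tree (heap_parent q) m)"
  shows "is_tree T" "order T = n" "max_degree T = Suc q"
    and "even (int n - int m + h_prime n (Suc q)) \<Longrightarrow> heap_count q m \<noteq> n - m \<Longrightarrow>
      int (set_dist T (subtree_core T) (center T)) = dist_bound n (Suc q)"
proof -
  note props = n_prime_props(1,2)[OF q, of n, folded m_def]
  have m0: "0 < m" using props(1) by simp
  then obtain h where h: "perfect_size q h < m" "m \<le> perfect_size q (Suc h)" using perfect_size_bracket[OF q] by blast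
  have len: "m + h \<le> n" "m < n" using path_length[OF q n] h unfolding m_def by auto
  interpret heap_with_tail q m n using q props(1) len by unfold_locales auto
  have T: "T = parent_tree (tail_parent q m) n"
    unfolding T_def using m0 len by (intro rgood_with_path_eq) (auto simp: m_def)
  show *: "is_tree T" "order T = n" "max_degree T = Suc q"
    unfolding T using tree max_degree_T by simp_all
  assume ev: "even (int n - int m + h_prime n (Suc q))" and ne: "heap_count q m \<noteq> n - m"
  have hp: "h_prime n (Suc q) = int h" using h_prime_eq[OF q] h unfolding m_def by blast
  obtain i where i: "n = m + 2 * i + h"
  proof -
    have "even (int n - int m + int h)" using ev hp by simp
    hence "even (int n - int m - int h)" by simp
    hence "even (n - (m + h))" using len by (simp add: of_nat_diff flip: even_of_nat_iff) presburger
    then obtain i where "n - (m + h) = 2 * i" by blast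
    hence "n = m + 2 * i + h" using len(1) by simp
    thus ?thesis by (rule that)
  qed
  have bound: "dist_bound n (Suc q) = int i"
    unfolding dist_bound_eq hp m_def[symmetric] by (simp add: i)
  \<comment> \<open>The definition of \<open>n_prime\<close> gives only the weak inequality;
    \<open>ne\<close> excludes the tie that would put the root and vertex \<open>m\<close> on a
    par.\<close>
  have "n - m < heap_count q m" using props(2) ne by simp
  hence "i \<le> set_dist T (subtree_core T) (center T)"
    using set_dist_T_ge[OF h i] unfolding T by (cases "i = 0") auto
  moreover have "int (set_dist T (subtree_core T) (center T)) \<le> dist_bound n (Suc q)"
    using set_dist_le_dist_bound[OF *(1,3) q] *(2) by simp
  ultimately show "int (set_dist T (subtree_core T) (center T)) = dist_bound n (Suc q)"
    using bound by simp
qed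

text \<open>Every order \<open>m\<close> beyond the smallest one is \<open>n_prime\<close> of some
  \<open>N\<close> meeting both conditions for equality: the gap between consecutive heap counts
  allows the parity to be adjusted without changing \<open>n_prime\<close>.\<close>

lemma exists_tight_order:
  assumes q: "2 \<le> q" and m: "Suc q < m"
  obtains N where "m < N" "n_prime N (Suc q) = m" "heap_count q m \<noteq> N - m"
    "even (int N - int m + h_prime N (Suc q))"
proof -
  have "0 < m" using m by simp
  then obtain h where h: "perfect_size q h < m" "m \<le> perfect_size q (Suc h)" using perfect_size_bracket[OF q] by blast
  \<comment> \<open>The path length must be below \<open>heap_count q m\<close> to avoid the tie and
    at least \<open>heap_count q (m - 1)\<close> so that order \<open>m - 1\<close> does not
    suffice. Both candidates satisfy this, and one has the parity of \<open>h\<close>.\<close>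
  define L where "L = (if even (heap_count q m - 1 + h) then heap_count q m - 1 else heap_count q m - 2)"
  have big: "4 \<le> heap_count q m" using heap_count_ge[OF q, of m] m q by simp
  have gap: "heap_count q (m - 1) + 2 \<le> heap_count q m" using heap_count_Suc_gap[OF q, of "m - 1"] m q by simp
  have L: "heap_count q (m - 1) \<le> L" "L < heap_count q m" "0 < L" "even (L + h)"
    using big gap by (auto simp: L_def)
  have np: "n_prime (m + L) (Suc q) = m"
  proof (rule antisym)
    show "n_prime (m + L) (Suc q) \<le> m" using L m by (intro n_prime_props(3)[OF q]) auto
    show "m \<le> n_prime (m + L) (Suc q)"
    proof (rule ccontr)
      let ?m = "n_prime (m + L) (Suc q)"
      assume *: "\<not> m \<le> ?m"
      hence "heap_count q ?m \<le> heap_count q (m - 1)" by (intro heap_count_mono[OF q]) simp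
      thus False using n_prime_props(2)[OF q, of "m + L"] L(1) * by simp
    qed
  qed
  have "h_prime (m + L) (Suc q) = int h" using h_prime_eq[OF q, of h "m + L"] h np by simp
  thus ?thesis using L np by (intro that[of "m + L"]) auto
qed

text \<open>Tightness is stated in two ways: equality for each \<open>n > k\<close> without rounding
  loss and without a tie between the root and its neighbour on the path, and the existence of
  infinitely many orders with equality, so that the conditional clause is not empty.\<close>

theorem theorem3p17:
  fixes n k :: nat
  assumes "n \<ge> 1" and "k \<ge> 3"
  shows
    "(\<forall>T :: 'a graph. is_tree T \<and> order T = n \<and> max_degree T = k \<longrightarrow>
        int (set_dist T (subtree_core T) (center T)) \<le> dist_bound n k)
   \<and> (n > k \<longrightarrow> (\<exists>Tu. extended_rgood k (n_prime n k) Tu \<and>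
        int (num_subtrees_at Tu 0) \<ge> int n - int (order Tu) \<and>
        (let T = rgood_with_path n k Tu in
           is_tree T \<and> order T = n \<and> max_degree T = k \<and>
           (even (int n - int (n_prime n k) + h_prime n k) \<and>
            int (num_subtrees_at Tu 0) \<noteq> int n - int (order Tu) \<longrightarrow>
              int (set_dist T (subtree_core T) (center T)) = dist_bound n k))))
   \<and> infinite {N. \<exists>Tu. extended_rgood k (n_prime N k) Tu \<and>
        (let T = rgood_with_path N k Tu in
           is_tree T \<and> order T = N \<and> max_degree T = k \<and>
           int (set_dist T (subtree_core T) (center T)) = dist_bound N k)}"
proof -
  define q where "q = k - 1"
  have q: "2 \<le> q" and k: "k = Suc q" using assms(2) by (auto simp: q_def)
  have rgood: "extended_rgood (Suc q) (n_prime N (Suc q)) (parent_tree (heap_parent q) (n_prime N (Suc q)))" for N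
    using extended_rgood_iff[OF q] n_prime_props(1)[OF q] by blast
  have num: "num_subtrees_at (parent_tree (heap_parent q) (n_prime N (Suc q))) 0 = heap_count q (n_prime N (Suc q))" for N
    using num_subtrees_heap[OF q] n_prime_props(1)[OF q, of N] by simp
  show ?thesis
    unfolding k
  proof (intro conjI allI impI, goal_cases)
    case (1 T)
    thus ?case using set_dist_le_dist_bound[OF _ _ q, of T] by blast
  next
    case 2
    note P = rgood_with_path_props[OF q 2]
    have "heap_count q (n_prime n (Suc q)) \<noteq> 0"
      using heap_count_ge[OF q, of "n_prime n (Suc q)"] n_prime_props(1)[OF q, of n] by linarith
    show ?case
      unfolding Let_def
    proof (intro exI[of _ "parent_tree (heap_parent q) (n_prime n (Suc q))"] conjI impI rgood P(1-3) P(4))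
      show "int n - int (order (parent_tree (heap_parent q) (n_prime n (Suc q))))
          \<le> int (num_subtrees_at (parent_tree (heap_parent q) (n_prime n (Suc q))) 0)"
        using n_prime_props(2)[OF q, of n] by (simp add: num)
    qed (use \<open>heap_count q (n_prime n (Suc q)) \<noteq> 0\<close> in \<open>auto simp: num\<close>)
  next
    case 3
    let ?S = "{N. \<exists>Tu. extended_rgood (Suc q) (n_prime N (Suc q)) Tu \<and>
        (let T = rgood_with_path N (Suc q) Tu in
           is_tree T \<and> order T = N \<and> max_degree T = Suc q \<and>
           int (set_dist T (subtree_core T) (center T)) = dist_bound N (Suc q))}"
    show ?case
    proof
      assume "finite ?S"
      \<comment> \<open>A heap of order beyond \<open>B\<close> already forces the order of the
        tight tree beyond \<open>B\<close>.\<close>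
      from this[unfolded finite_nat_set_iff_bounded] obtain B where B: "\<forall>N\<in>?S. N < B" ..
      obtain N where N: "Suc q + Suc B < N" "n_prime N (Suc q) = Suc q + Suc B"
        "heap_count q (Suc q + Suc B) \<noteq> N - (Suc q + Suc B)"
        "even (int N - int (Suc q + Suc B) + h_prime N (Suc q))"
        using exists_tight_order[OF q, of "Suc q + Suc B"] by auto
      have "Suc q < N" using N(1) by simp
      note P = rgood_with_path_props[OF q this]
      note tight = P(4)[unfolded N(2), OF N(4,3)]
      have "N \<in> ?S"
        unfolding Let_def
        by (intro CollectI exI[of _ "parent_tree (heap_parent q) (n_prime N (Suc q))"] conjI rgood P(1-3))
           (use tight in \<open>simp only: N(2)\<close>)
      hence "N < B" using B by (rule bspec[rotated])
      thus False using N(1) by simp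
    qed
  qed
qed

end
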